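(* Let $t\ge3$ be an integer, $c>0$ a constant, $G=G_{n,c/n}$, and let $\Delta=\Delta(G)$ be its maximum degree. Then there exist constants $c_1,c_2>0$ (depending on $t$) such that with high probability \[c_1\sqrt{\Delta}\le\tau_t(G_{n,c/n})\le c_2\sqrt{\Delta}.\]
   Context: A (proper) $t$-tone $k$-coloring of a graph $G$ is a function $f:V(G)\to\binom{[k]}{t}$ such that $|f(u)\cap f(v)|<d(u,v)$ for all distinct vertices $u,v$ ($d$ = graph distance); $\tau_t(G)$ is the least $k$ for which such a coloring exists. $G_{n,p}$ is the Erdős–Rényi random graph on $[n]$; "with high probability" means with probability $\to1$ as $n\to\infty$. *)

theory Defs
  imports "HOL-Probability.Probability"
begin

text \<open>A graph on vertex set {0..<n} is given by its edge set E, a set of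
  2-element subsets of {0..<n}.\<close>

definition all_pairs :: "nat \<Rightarrow> nat set set" where
  "all_pairs n = {e. e \<subseteq> {..<n} \<and> card e = 2}"

definition gnp :: "nat \<Rightarrow> real \<Rightarrow> nat set set pmf" where
  "gnp n p = map_pmf (\<lambda>b. {e \<in> all_pairs n. b e})
                     (Pi_pmf (all_pairs n) False (\<lambda>_. bernoulli_pmf p))"

text \<open>Graph distance: least length of a walk from u to v (infinity if none).\<close>
definition gdist :: "nat set set \<Rightarrow> nat \<Rightarrow> nat \<Rightarrow> enat" where
  "gdist E u v = (INF k \<in> {k. \<exists>w. length w = Suc k \<and> hd w = u \<and> last w = v \<and>
                       (\<forall>i<k. {w ! i, w ! Suc i} \<in> E)}. enat k)"

definition tone_coloring :: "nat \<Rightarrow> nat set set \<Rightarrow> nat \<Rightarrow> nat \<Rightarrow> (nat \<Rightarrow> nat set) \<Rightarrow> bool" where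
  "tone_coloring n E t k f \<longleftrightarrow>
     (\<forall>v<n. f v \<subseteq> {1..k} \<and> card (f v) = t) \<and>
     (\<forall>u<n. \<forall>v<n. u \<noteq> v \<longrightarrow> enat (card (f u \<inter> f v)) < gdist E u v)"

definition tau :: "nat \<Rightarrow> nat \<Rightarrow> nat set set \<Rightarrow> nat" where
  "tau t n E = (LEAST k. \<exists>f. tone_coloring n E t k f)"

definition max_degree :: "nat \<Rightarrow> nat set set \<Rightarrow> nat" where
  "max_degree n E = Max (insert 0 ((\<lambda>v. card {u. {u, v} \<in> E}) ` {..<n}))"

end

(*
  Lower bound: the neighbours of a vertex are pairwise at distance at most 2, so their label sets
  share at most one label, and \<Delta> \<le> (k choose 2).

  Upper bound: write \<Delta> \<approx> r^4. A greedy colouring with C r^2 colours succeeds if every vertex sees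
  O(r^(2j)) already coloured vertices at distance j, for 1 \<le> j \<le> t. With high probability the
  degrees over any connected set of at most A r^3 vertices sum to O(r^4), and balls of radius j have
  size O(r^(3+j)), which settles all j \<ge> 3. For j \<le> 2, colour the set H of vertices of degree
  above r^2 first: every vertex has only O(r^2) members of H within distance 2, since more of them
  would give a small connected set with too large a degree sum. A vertex outside H has at most r^2
  neighbours, and the degrees of its neighbours sum to O(r^4).

  The sparsity is a union bound over a spanning tree of the connected set and the remaining
  incident edges; counting unlabelled tree shapes costs only a constant factor per vertex, whereas
  the surplus edges cost a factor r each, and r is chosen such that log n is of
  order r^4 log r.
*)
theory Submission
  imports Defs "HOL-Library.Tree"
begin

section \<open>Degrees, distances and the lower bound\<close>

definition nbrs :: "nat set set \<Rightarrow> nat \<Rightarrow> nat set" where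
  "nbrs E v = {u. {u, v} \<in> E}"

definition deg :: "nat set set \<Rightarrow> nat \<Rightarrow> nat" where
  "deg E v = card (nbrs E v)"

text \<open>Ends of the walks with exactly \<open>j\<close> steps from \<open>v\<close>. Vertices
  closer than \<open>j\<close> may occur, which is harmless for upper bounds on counts and keeps the
  recursion simple.\<close>

primrec reach :: "nat set set \<Rightarrow> nat \<Rightarrow> nat \<Rightarrow> nat set" where
  "reach E v 0 = {v}"
| "reach E v (Suc j) = (\<Union>u\<in>reach E v j. nbrs E u)"

lemma finite_all_pairs [simp]: "finite (all_pairs n)"
  by (rule finite_subset[of _ "Pow {..<n}"]) (auto simp: all_pairs_def)

lemma nbrs_subset: "E \<subseteq> all_pairs n \<Longrightarrow> nbrs E v \<subseteq> {..<n}"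
  by (auto simp: nbrs_def all_pairs_def)

lemma finite_nbrs: "E \<subseteq> all_pairs n \<Longrightarrow> finite (nbrs E v)"
  by (rule finite_subset[OF nbrs_subset]) auto

lemma deg_le_max_degree: "v < n \<Longrightarrow> deg E v \<le> max_degree n E"
  unfolding max_degree_def deg_def nbrs_def by (intro Max_ge) auto

lemma max_degree_cases: "max_degree n E = 0 \<or> (\<exists>v<n. max_degree n E = deg E v)"
proof -
  have "max_degree n E \<in> insert 0 ((\<lambda>v. card {u. {u, v} \<in> E}) ` {..<n})"
    unfolding max_degree_def by (rule Max_in) auto
  thus ?thesis unfolding deg_def nbrs_def by auto
qed

lemma gdist_leI:
  assumes "length w = Suc k" "hd w = u" "last w = v" "\<And>i. i < k \<Longrightarrow> {w ! i, w ! Suc i} \<in> E"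
  shows "gdist E u v \<le> enat k"
  unfolding gdist_def using assms by (intro INF_lower) auto

lemma walk_reach:
  assumes "length w = Suc k" "last w = v" "\<forall>i<k. {w ! i, w ! Suc i} \<in> E"
  shows "hd w \<in> reach E v k"
  using assms
proof (induction k arbitrary: w)
  case 0
  then show ?case by (cases w) auto
next
  case (Suc k)
  from Suc.prems(1) obtain a b ws where w: "w = a # b # ws" by (cases w; cases "tl w") auto
  have "hd (b # ws) \<in> reach E v k"
  proof (rule Suc.IH)
    show "\<forall>i<k. {(b # ws) ! i, (b # ws) ! Suc i} \<in> E"
    proof (intro allI impI)
      fix i assume "i < k"
      thus "{(b # ws) ! i, (b # ws) ! Suc i} \<in> E" using Suc.prems(3)[rule_format, of "Suc i"] w by simp
    qed
  qed (use Suc.prems w in auto)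
  moreover have "{a, b} \<in> E" using Suc.prems(3)[rule_format, of 0] w by simp
  ultimately show ?case using w by (auto simp: nbrs_def)
qed

text \<open>A finite infimum in \<open>enat\<close> is attained, so some walk has exactly
  \<open>j\<close> steps.\<close>

lemma gdist_eq_enat_reach:
  assumes "gdist E u v = enat j"
  shows "u \<in> reach E v j"
proof -
  define K where "K = {k. \<exists>w. length w = Suc k \<and> hd w = u \<and> last w = v \<and>
                       (\<forall>i<k. {w ! i, w ! Suc i} \<in> E)}"
  have eq: "Inf (enat ` K) = enat j"
    using assms by (simp add: gdist_def K_def)
  hence "K \<noteq> {}" by (auto simp: top_enat_def)
  hence "Inf (enat ` K) \<in> enat ` K"
    unfolding Inf_enat_def by (auto intro: LeastI)
  hence "j \<in> K" using eq by auto
  thus ?thesis unfolding K_def using walk_reach by blast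
qed

lemma gdist_pos: "u \<noteq> v \<Longrightarrow> 0 < gdist E u v"
  using gdist_eq_enat_reach[of E u v 0] by (auto simp: zero_enat_def[symmetric])

section \<open>Existence of tone colourings and the lower bound on \<open>tau\<close>\<close>

text \<open>Pairwise disjoint label sets always work. Without such a witness the
  \<open>LEAST\<close> in \<open>tau\<close> would say nothing.\<close>

lemma tone_coloring_exists: "\<exists>k f. tone_coloring n E t k f"
proof (intro exI)
  let ?f = "\<lambda>v. {v * t + 1..v * t + t}"
  have disj: "?f u \<inter> ?f v = {}" if "u < v" for u v :: nat
  proof -
    have "Suc u * t \<le> v * t" using that by (intro mult_right_mono) auto
    thus ?thesis by auto
  qed
  have disj': "?f u \<inter> ?f v = {}" if "u \<noteq> v" for u v :: nat
    using disj[of u v] disj[of v u] that by (cases "u < v") auto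
  have "v * t + t \<le> n * t" if "v < n" for v
    using mult_right_mono[of "Suc v" n t] that by auto
  thus "tone_coloring n E t (n * t) ?f"
    unfolding tone_coloring_def using disj' gdist_pos
    by (force simp: zero_enat_def[symmetric])
qed

lemma tau_coloring: "\<exists>f. tone_coloring n E t (tau t n E) f"
  unfolding tau_def using tone_coloring_exists by (rule LeastI_ex)

lemma tau_le: "tone_coloring n E t k f \<Longrightarrow> tau t n E \<le> k"
  unfolding tau_def by (rule Least_le) auto

text \<open>Two neighbours of a vertex share at most one label, so the pairs of labels picked from the
  label sets of the neighbours are distinct.\<close>

lemma deg_le_tone_coloring:
  assumes f: "tone_coloring n E t k f" and E: "E \<subseteq> all_pairs n" and t: "t \<ge> 2"
  shows "deg E v \<le> k\<^sup>2"
proof -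
  have "\<exists>g. \<forall>u\<in>nbrs E v. g u \<subseteq> f u \<and> card (g u) = 2"
  proof (intro bchoice ballI)
    fix u assume "u \<in> nbrs E v"
    hence "card (f u) \<ge> 2"
      using f t nbrs_subset[OF E, of v] by (auto simp: tone_coloring_def)
    thus "\<exists>X. X \<subseteq> f u \<and> card X = 2" using obtain_subset_with_card_n by metis
  qed
  then obtain g where g: "\<And>u. u \<in> nbrs E v \<Longrightarrow> g u \<subseteq> f u \<and> card (g u) = 2" by blast
  have inj: "inj_on g (nbrs E v)"
  proof (rule inj_onI, rule ccontr)
    fix a b assume ab: "a \<in> nbrs E v" "b \<in> nbrs E v" "g a = g b" "a \<noteq> b"
    have "gdist E a b \<le> enat 2"
      using ab by (intro gdist_leI[of "[a, v, b]"])
        (auto simp: nbrs_def less_Suc_eq numeral_2_eq_2 insert_commute)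
    moreover have "enat (card (f a \<inter> f b)) < gdist E a b"
      using f ab nbrs_subset[OF E, of v] unfolding tone_coloring_def by blast
    ultimately have "card (f a \<inter> f b) < 2" by (metis enat_ord_simps(2) order_less_le_trans)
    moreover have "g a \<subseteq> f a \<inter> f b" using g ab by (metis Int_greatest)
    moreover have "f a \<subseteq> {1..k}" using f ab nbrs_subset[OF E, of v]
      unfolding tone_coloring_def by blast
    hence "finite (f a)" by (rule finite_subset) simp
    ultimately show False using card_mono[of "f a \<inter> f b" "g a"] g[OF ab(1)] by auto
  qed
  have sub: "g ` nbrs E v \<subseteq> {X. X \<subseteq> {1..k} \<and> card X = 2}"
  proof
    fix X assume "X \<in> g ` nbrs E v"
    then obtain u where u: "u \<in> nbrs E v" "X = g u" by blast
    hence "f u \<subseteq> {1..k}" using f nbrs_subset[OF E, of v] unfolding tone_coloring_def by blast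
    thus "X \<in> {X. X \<subseteq> {1..k} \<and> card X = 2}" using g[OF u(1)] u by auto
  qed
  have "card (g ` nbrs E v) \<le> k choose 2"
    using card_mono[OF _ sub] n_subsets[of "{1..k}" 2] by (auto)
  also have "\<dots> \<le> k\<^sup>2" by (cases "k \<ge> 2") (auto intro: binomial_le_pow simp: binomial_eq_0)
  finally show ?thesis using card_image[OF inj] by (simp add: deg_def)
qed

lemma sqrt_max_degree_le_tau:
  assumes "E \<subseteq> all_pairs n" "t \<ge> 2"
  shows "sqrt (real (max_degree n E)) \<le> real (tau t n E)"
proof -
  obtain f where f: "tone_coloring n E t (tau t n E) f" using tau_coloring by blast
  have "max_degree n E \<le> (tau t n E)\<^sup>2"
    using max_degree_cases[of n E] deg_le_tone_coloring[OF f assms] by auto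
  hence "real (max_degree n E) \<le> (real (tau t n E))\<^sup>2"
    by (metis of_nat_le_iff of_nat_power)
  thus ?thesis by (simp add: real_le_lsqrt)
qed

section \<open>Greedy colouring\<close>

lemma gdist_commute: "gdist E u v = gdist E v u"
proof -
  have *: "gdist E u v \<le> gdist E v u" for u v
  proof -
    have "gdist E u v \<le> enat k"
      if w: "length w = Suc k" "hd w = v" "last w = u" "\<forall>i<k. {w ! i, w ! Suc i} \<in> E" for k w
    proof (rule gdist_leI[of "rev w"])
      fix i assume i: "i < k"
      have "{w ! (k - Suc i), w ! Suc (k - Suc i)} \<in> E" using w(4) i by auto
      thus "{rev w ! i, rev w ! Suc i} \<in> E"
        using i w(1) by (simp add: rev_nth Suc_diff_Suc insert_commute)
    qed (use w in \<open>auto simp: hd_rev last_rev\<close>)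
    thus ?thesis unfolding gdist_def[of E v u] by (intro INF_greatest) auto
  qed
  show ?thesis by (intro antisym *)
qed

text \<open>The colours are split into \<open>t\<close> blocks of size \<open>K\<close>, and a label set takes one colour from each
  block; label sets then are functions \<open>{..<t} \<rightarrow> {..<K}\<close>.\<close>

definition label_set :: "nat \<Rightarrow> nat \<Rightarrow> (nat \<Rightarrow> nat) \<Rightarrow> nat set" where
  "label_set t K x = (\<lambda>i. i * K + x i + 1) ` {..<t}"

definition agree :: "nat \<Rightarrow> (nat \<Rightarrow> nat) \<Rightarrow> (nat \<Rightarrow> nat) \<Rightarrow> nat set" where
  "agree t x y = {i. i < t \<and> x i = y i}"

lemma agree_commute: "agree t x y = agree t y x"
proof -
  have "x i = y i \<longleftrightarrow> y i = x i" for i by (rule eq_commute)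
  thus ?thesis by (simp only: agree_def)
qed

lemma card_agree_le: "card (agree t x y) \<le> t"
proof -
  have "agree t x y \<subseteq> {..<t}" by (auto simp: agree_def)
  hence "card (agree t x y) \<le> card {..<t}" by (rule card_mono[rotated]) simp
  thus ?thesis by simp
qed

lemma block_code_inj:
  fixes K :: nat
  assumes "i * K + a = j * K + b" "a < K" "b < K"
  shows "i = j \<and> a = b"
proof -
  have "(i * K + a) div K = (j * K + b) div K" "(i * K + a) mod K = (j * K + b) mod K"
    using assms(1) by simp_all
  thus ?thesis using assms(2,3) by simp
qed

lemma label_set_props:
  assumes "x \<in> {..<t} \<rightarrow>\<^sub>E {..<K}"
  shows "label_set t K x \<subseteq> {1..t * K}" "card (label_set t K x) = t"
proof -
  have "i * K + x i + 1 \<le> t * K" if "i < t" for i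
  proof -
    have "x i < K" using assms that by auto
    moreover have "Suc i * K \<le> t * K" using that by (intro mult_right_mono) auto
    ultimately show ?thesis by auto
  qed
  thus "label_set t K x \<subseteq> {1..t * K}" by (auto simp: label_set_def)
  have "inj_on (\<lambda>i. i * K + x i + 1) {..<t}"
  proof (rule inj_onI)
    fix i j assume ij: "i \<in> {..<t}" "j \<in> {..<t}" "i * K + x i + 1 = j * K + x j + 1"
    thus "i = j" using block_code_inj[of i K "x i" j "x j"] assms by auto
  qed
  thus "card (label_set t K x) = t" by (simp add: label_set_def card_image)
qed

text \<open>A common label determines its block, and in that block both functions have chosen
  it.\<close>

lemma card_label_set_Int:
  assumes "x \<in> {..<t} \<rightarrow>\<^sub>E {..<K}" "y \<in> {..<t} \<rightarrow>\<^sub>E {..<K}"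
  shows "card (label_set t K x \<inter> label_set t K y) \<le> card (agree t x y)"
proof -
  have "label_set t K x \<inter> label_set t K y \<subseteq> (\<lambda>i. i * K + x i + 1) ` agree t x y"
  proof
    fix z assume "z \<in> label_set t K x \<inter> label_set t K y"
    then obtain i j where ij: "i < t" "j < t" "z = i * K + x i + 1" "z = j * K + y j + 1"
      by (auto simp: label_set_def)
    have "x i < K" "y j < K" using assms ij by auto
    hence "i = j \<and> x i = y j" using ij by (intro block_code_inj) auto
    thus "z \<in> (\<lambda>i. i * K + x i + 1) ` agree t x y"
      using ij by (intro image_eqI[of _ _ i]) (auto simp: agree_def)
  qed
  moreover have fin: "finite (agree t x y)" by (auto simp: agree_def)
  ultimately show ?thesis
    by (meson card_image_le card_mono finite_imageI le_trans)
qed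

text \<open>Union bound over the set \<open>J\<close> of \<open>j\<close> coordinates where
  \<open>y\<close> must follow \<open>x\<close>: there are at most \<open>2 ^ t\<close> such sets,
  and each leaves \<open>t - j\<close> coordinates free.\<close>

lemma card_agreeing_functions:
  assumes "x \<in> {..<t} \<rightarrow>\<^sub>E {..<K}" "j \<le> t"
  shows "card {y \<in> {..<t} \<rightarrow>\<^sub>E {..<K}. j \<le> card (agree t x y)} \<le> 2 ^ t * K ^ (t - j)"
proof -
  define S where "S = {J. J \<subseteq> {..<t} \<and> card J = j}"
  define P where "P J = PiE {..<t} (\<lambda>i. if i \<in> J then {x i} else {..<K})" for J
  have cardP: "card (P J) = K ^ (t - j)" if "J \<in> S" for J
  proof -
    have J: "J \<subseteq> {..<t}" "card J = j" "finite J" using that by (auto simp: S_def intro: finite_subset)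
    have "card (P J) = (\<Prod>i<t. if i \<in> J then 1 else K)"
      unfolding P_def by (subst card_PiE) (auto intro!: prod.cong)
    also have "\<dots> = (\<Prod>i\<in>{..<t} - J. K)"
      using J by (intro prod.mono_neutral_cong_right) auto
    finally show ?thesis using J by (simp add: card_Diff_subset)
  qed
  have fin: "finite S" by (auto simp: S_def)
  have "card S \<le> card (Pow {..<t})" by (intro card_mono) (auto simp: S_def)
  hence cardS: "card S \<le> 2 ^ t" by (simp add: card_Pow)
  have "{y \<in> {..<t} \<rightarrow>\<^sub>E {..<K}. j \<le> card (agree t x y)} \<subseteq> (\<Union>J\<in>S. P J)"
  proof safe
    fix y assume y: "y \<in> {..<t} \<rightarrow>\<^sub>E {..<K}" "j \<le> card (agree t x y)"
    then obtain J where J: "J \<subseteq> agree t x y" "card J = j"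
      using obtain_subset_with_card_n by metis
    hence "J \<in> S" "y \<in> P J" using y by (auto simp: S_def P_def agree_def PiE_iff)
    thus "y \<in> (\<Union>J\<in>S. P J)" by blast
  qed
  hence "card {y \<in> {..<t} \<rightarrow>\<^sub>E {..<K}. j \<le> card (agree t x y)} \<le> card (\<Union>J\<in>S. P J)"
    using fin by (intro card_mono) (auto simp: P_def intro!: finite_PiE)
  also have "\<dots> \<le> (\<Sum>J\<in>S. card (P J))" by (rule card_UN_le[OF fin])
  also have "\<dots> = card S * K ^ (t - j)" using cardP by simp
  also have "\<dots> \<le> 2 ^ t * K ^ (t - j)" using cardS by (intro mult_right_mono) auto
  finally show ?thesis .
qed

section \<open>Greedy extension of partial colourings\<close>

text \<open>Distances are those of the whole graph, so a colouring of a subset stays valid when more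
  vertices are coloured.\<close>

definition good_on :: "nat set set \<Rightarrow> nat \<Rightarrow> nat \<Rightarrow> nat set \<Rightarrow> (nat \<Rightarrow> nat \<Rightarrow> nat) \<Rightarrow> bool" where
  "good_on E t K W g \<longleftrightarrow> g ` W \<subseteq> {..<t} \<rightarrow>\<^sub>E {..<K} \<and>
     (\<forall>u\<in>W. \<forall>v\<in>W. u \<noteq> v \<longrightarrow> enat (card (agree t (g u) (g v))) < gdist E u v)"

definition at_dist :: "nat set set \<Rightarrow> nat set \<Rightarrow> nat \<Rightarrow> nat \<Rightarrow> nat set" where
  "at_dist E W v j = {u \<in> W. gdist E u v = enat j}"

text \<open>The vertices of \<open>X\<close> are coloured one by one. A coloured vertex at distance
  \<open>j\<close> rules out the functions that agree with its own in \<open>j\<close> or more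
  places; by hypothesis fewer than \<open>K ^ t\<close> functions are ruled out in total, so one is
  left.\<close>

lemma greedy_extension:
  assumes "finite X" "finite W" "good_on E t K W g"
    and "\<And>v. v \<in> X \<Longrightarrow>
      (\<Sum>j=1..t. card (at_dist E (W \<union> X) v j) * (2 ^ t * K ^ (t - j))) < K ^ t"
  shows "\<exists>g. good_on E t K (W \<union> X) g"
  using assms(1,4)
proof (induction X rule: finite_induct)
  case empty
  thus ?case using assms(3) by auto
next
  case (insert v X)
  have mono: "(\<Sum>j=1..t. card (at_dist E (W \<union> X) u j) * (2 ^ t * K ^ (t - j)))
     \<le> (\<Sum>j=1..t. card (at_dist E (W \<union> insert v X) u j) * (2 ^ t * K ^ (t - j)))" for u
    using insert.hyps(1) assms(2)
    by (intro sum_mono mult_right_mono card_mono) (auto simp: at_dist_def)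
  have "\<exists>g. good_on E t K (W \<union> X) g"
    using mono insert.prems by (intro insert.IH) (meson insertCI le_less_trans)
  then obtain g where g: "good_on E t K (W \<union> X) g" by blast
  show ?case
  proof (cases "v \<in> W \<union> X")
    case True
    hence "W \<union> insert v X = W \<union> X" by auto
    thus ?thesis using g by auto
  next
    case False
    let ?Y = "{..<t} \<rightarrow>\<^sub>E {..<K}"
    define bad where "bad = (\<Union>j\<in>{1..t}. \<Union>u\<in>at_dist E (W \<union> X) v j.
        {y \<in> ?Y. j \<le> card (agree t (g u) y)})"
    have finN: "finite (at_dist E (W \<union> X) v j)" for j
      using insert.hyps(1) assms(2) by (auto simp: at_dist_def)
    have "card bad \<le> (\<Sum>j=1..t. card (\<Union>u\<in>at_dist E (W \<union> X) v j.
        {y \<in> ?Y. j \<le> card (agree t (g u) y)}))"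
      unfolding bad_def by (rule card_UN_le) auto
    also have "\<dots> \<le> (\<Sum>j=1..t. card (at_dist E (W \<union> X) v j) * (2 ^ t * K ^ (t - j)))"
    proof (intro sum_mono)
      fix j assume j: "j \<in> {1..t}"
      have "card (\<Union>u\<in>at_dist E (W \<union> X) v j. {y \<in> ?Y. j \<le> card (agree t (g u) y)})
          \<le> (\<Sum>u\<in>at_dist E (W \<union> X) v j. card {y \<in> ?Y. j \<le> card (agree t (g u) y)})"
        by (rule card_UN_le[OF finN])
      also have "\<dots> \<le> (\<Sum>u\<in>at_dist E (W \<union> X) v j. 2 ^ t * K ^ (t - j))"
        using g j by (intro sum_mono card_agreeing_functions) (auto simp: good_on_def at_dist_def)
      finally show "card (\<Union>u\<in>at_dist E (W \<union> X) v j. {y \<in> ?Y. j \<le> card (agree t (g u) y)})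
          \<le> card (at_dist E (W \<union> X) v j) * (2 ^ t * K ^ (t - j))" by simp
    qed
    also have "\<dots> < K ^ t" using mono[of v] insert.prems[of v] by auto
    finally have "card bad < card ?Y" by (simp add: card_PiE)
    moreover have "finite ?Y" by (intro finite_PiE) auto
    hence "finite bad" by (rule finite_subset[rotated]) (unfold bad_def, blast)
    ultimately have "\<not> ?Y \<subseteq> bad" using card_mono[of bad ?Y] by linarith
    then obtain y where y: "y \<in> ?Y" "y \<notin> bad" by blast
    have ok: "enat (card (agree t (g u) y)) < gdist E u v" if u: "u \<in> W \<union> X" for u
    proof (cases "gdist E u v")
      case (enat j)
      have "u \<noteq> v" using u False by auto
      hence "j \<noteq> 0" using gdist_pos[of u v E] enat by (auto simp: zero_enat_def)
      \<comment> \<open>Beyond distance \<open>t\<close> there is no constraint, since two functions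
        agree in at most \<open>t\<close> places; this is why \<open>bad\<close> stops at
        \<open>t\<close>.\<close>
      show ?thesis
      proof (cases "j \<le> t")
        case True
        hence "\<not> j \<le> card (agree t (g u) y)"
          using y u enat \<open>j \<noteq> 0\<close> by (force simp: bad_def at_dist_def)
        thus ?thesis using enat by simp
      qed (use enat card_agree_le[of t "g u" y] in auto)
    qed auto
    have "good_on E t K (W \<union> insert v X) (g(v := y))"
      unfolding good_on_def
    proof (intro conjI ballI impI)
      show "(g(v := y)) ` (W \<union> insert v X) \<subseteq> ?Y"
        using g y(1) by (auto simp: good_on_def)
    next
      fix a b assume ab: "a \<in> W \<union> insert v X" "b \<in> W \<union> insert v X" "a \<noteq> b"
      show "enat (card (agree t ((g(v := y)) a) ((g(v := y)) b))) < gdist E a b"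
      proof (cases "a = v")
        case True
        hence "b \<in> W \<union> X" "b \<noteq> v" using ab by auto
        thus ?thesis using ok[of b] True
          by (simp add: agree_commute[of t y "g b"] gdist_commute[of E v b])
      next
        case False
        hence "a \<in> W \<union> X" using ab by auto
        thus ?thesis using ok[of a] g ab False by (auto simp: good_on_def)
      qed
    qed
    thus ?thesis by blast
  qed
qed

lemma good_on_tone_coloring:
  assumes "good_on E t K {..<n} g"
  shows "tone_coloring n E t (t * K) (\<lambda>v. label_set t K (g v))"
proof -
  have g: "g v \<in> {..<t} \<rightarrow>\<^sub>E {..<K}" if "v < n" for v
    using assms that by (auto simp: good_on_def)
  have "enat (card (label_set t K (g u) \<inter> label_set t K (g v))) < gdist E u v"
    if "u < n" "v < n" "u \<noteq> v" for u v
  proof -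
    have "enat (card (agree t (g u) (g v))) < gdist E u v"
      using assms that by (auto simp: good_on_def)
    thus ?thesis using card_label_set_Int[OF g[OF that(1)] g[OF that(2)]]
      by (meson enat_ord_simps(1) le_less_trans)
  qed
  thus ?thesis using label_set_props[OF g] unfolding tone_coloring_def by blast
qed

text \<open>While \<open>H\<close> is coloured only members of \<open>H\<close> count; the second
  phase faces all vertices. With \<open>K = D * s\<close>, the at most \<open>A * s ^ j\<close>
  vertices at distance \<open>j\<close> exclude at most a fraction \<open>A * 2 ^ t / D\<close> of
  the \<open>K ^ t\<close> functions, so the \<open>t\<close> distances together do not exclude all
  of them.\<close>

lemma two_phase_tau_le:
  fixes t A D s n :: nat
  assumes D: "D > t * 2 ^ t * A" and s: "s > 0"
    and H: "H \<subseteq> {..<n}"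
    and 1: "\<And>v j. v \<in> H \<Longrightarrow> j \<in> {1..t} \<Longrightarrow> card (at_dist E H v j) \<le> A * s ^ j"
    and 2: "\<And>v j. v \<in> {..<n} - H \<Longrightarrow> j \<in> {1..t} \<Longrightarrow> card (at_dist E {..<n} v j) \<le> A * s ^ j"
  shows "tau t n E \<le> t * (D * s)"
proof -
  let ?K = "D * s"
  have bound: "(\<Sum>j=1..t. N j * (2 ^ t * ?K ^ (t - j))) < ?K ^ t"
    if N: "\<And>j. j \<in> {1..t} \<Longrightarrow> N j \<le> A * s ^ j" for N :: "nat \<Rightarrow> nat"
  proof -
    have "D * (N j * (2 ^ t * ?K ^ (t - j))) \<le> A * 2 ^ t * ?K ^ t" if j: "j \<in> {1..t}" for j
    proof -
      have "D * (N j * (2 ^ t * ?K ^ (t - j))) \<le> D * (A * s ^ j * (2 ^ t * ?K ^ (t - j)))"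
        using N[OF j] by (intro mult_left_mono mult_right_mono) auto
      also have "\<dots> = A * 2 ^ t * (D * s ^ j) * ?K ^ (t - j)" by (simp add: algebra_simps)
      also have "\<dots> \<le> A * 2 ^ t * ?K ^ j * ?K ^ (t - j)"
      proof -
        \<comment> \<open>\<open>D * s ^ j \<le> (D * s) ^ j\<close> because
          \<open>j \<ge> 1\<close>; this is where the gain of \<open>1 / D\<close> comes
          from.\<close>
        have "D ^ 1 \<le> D ^ j" using D j by (intro power_increasing) auto
        thus ?thesis by (intro mult_right_mono mult_left_mono) (auto simp: power_mult_distrib)
      qed
      also have "\<dots> = A * 2 ^ t * ?K ^ t" using j by (simp add: mult.assoc flip: power_add)
      finally show ?thesis .
    qed
    hence "D * (\<Sum>j=1..t. N j * (2 ^ t * ?K ^ (t - j))) \<le> (\<Sum>j=1..t. A * 2 ^ t * ?K ^ t)"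
      unfolding sum_distrib_left by (intro sum_mono) auto
    also have "\<dots> = (t * 2 ^ t * A) * ?K ^ t" by simp
    also have "\<dots> < D * ?K ^ t" using D s by (intro mult_strict_right_mono) auto
    finally show ?thesis by simp
  qed
  have "finite H" using H finite_subset by blast
  \<comment> \<open>On the empty set any function is a valid start.\<close>
  have "\<exists>g. good_on E t ?K ({} \<union> H) g"
    using \<open>finite H\<close> 1 by (intro greedy_extension[where g = undefined] bound) (auto simp: good_on_def)
  then obtain g where "good_on E t ?K H g" by auto
  moreover have "H \<union> ({..<n} - H) = {..<n}" using H by auto
  ultimately have "\<exists>g. good_on E t ?K (H \<union> ({..<n} - H)) g"
    using \<open>finite H\<close> 2 by (intro greedy_extension[where g = g] bound) auto
  then obtain g where "good_on E t ?K {..<n} g" using \<open>H \<union> ({..<n} - H) = {..<n}\<close> by auto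
  thus ?thesis by (intro tau_le[OF good_on_tone_coloring])
qed

section \<open>Colouring sparse graphs\<close>

text \<open>Connected vertex sets, grown from \<open>v\<close> by one adjacent vertex at a time;
  each growth step will add one leaf to a spanning tree.\<close>

inductive conn :: "nat set set \<Rightarrow> nat \<Rightarrow> nat set \<Rightarrow> bool" for E v where
  conn_root: "conn E v {v}"
| conn_insert: "conn E v S \<Longrightarrow> u \<in> S \<Longrightarrow> w \<notin> S \<Longrightarrow> {w, u} \<in> E \<Longrightarrow> conn E v (insert w S)"

lemma conn_finite: "conn E v S \<Longrightarrow> finite S"
  by (induction rule: conn.induct) auto

lemma conn_Un:
  assumes "finite W" "conn E v S" "\<And>w. w \<in> W \<Longrightarrow> \<exists>u\<in>S. w \<in> nbrs E u"
  shows "conn E v (S \<union> W)"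
  using assms(1,3)
proof (induction W rule: finite_induct)
  case (insert w W)
  hence IH: "conn E v (S \<union> W)" by auto
  obtain u where "u \<in> S" "{w, u} \<in> E" using insert.prems[of w] by (auto simp: nbrs_def)
  thus ?case using IH conn_insert[of E v "S \<union> W" u w] by (cases "w \<in> S \<union> W") (auto simp: insert_absorb)
qed (use assms(2) in auto)

text \<open>The degree sum bounds both the size of the neighbourhood of \<open>S\<close> and the
  number of vertices of large degree in \<open>S\<close>.\<close>

definition sparse :: "nat \<Rightarrow> nat set set \<Rightarrow> nat \<Rightarrow> nat \<Rightarrow> bool" where
  "sparse n E m q \<longleftrightarrow> (\<forall>v<n. \<forall>S. conn E v S \<longrightarrow> card S \<le> m \<longrightarrow> (\<Sum>u\<in>S. deg E u) \<le> q)"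

lemma sparseD: "sparse n E m q \<Longrightarrow> v < n \<Longrightarrow> conn E v S \<Longrightarrow> card S \<le> m \<Longrightarrow> (\<Sum>u\<in>S. deg E u) \<le> q"
  by (auto simp: sparse_def)

lemma card_UN_nbrs_le:
  assumes "finite S"
  shows "card (\<Union>u\<in>S. nbrs E u) \<le> (\<Sum>u\<in>S. deg E u)"
  using card_UN_le[OF assms, of "nbrs E"] by (simp add: deg_def)

text \<open>Adding all neighbours keeps a set connected, and by sparsity it multiplies the size
  bound by at most \<open>1 + 4 * r \<le> 5 * r\<close>. The bounds start from \<open>m\<close>
  instead of 1 because sparsity will be available only for sizes of order \<open>r ^ 3\<close> and
  above.\<close>

lemma reach_conn_card:
  assumes E: "E \<subseteq> all_pairs n" and v: "v < n" and m: "m \<ge> 1" and r: "r \<ge> 1"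
    and sp: "\<And>i. i < j \<Longrightarrow> sparse n E (m * (5 * r) ^ i) (4 * r * (m * (5 * r) ^ i))"
  shows "\<exists>S. conn E v S \<and> reach E v j \<subseteq> S \<and> card S \<le> m * (5 * r) ^ j"
  using sp
proof (induction j)
  case 0
  show ?case using m by (intro exI[of _ "{v}"]) (auto intro: conn_root)
next
  case (Suc j)
  then obtain S where S: "conn E v S" "reach E v j \<subseteq> S" "card S \<le> m * (5 * r) ^ j"
    by (metis less_SucI)
  let ?N = "\<Union>u\<in>S. nbrs E u"
  have fin: "finite S" using conn_finite S(1) .
  have "card (S \<union> ?N) \<le> card S + card ?N" by (rule card_Un_le)
  also have "\<dots> \<le> m * (5 * r) ^ j + 4 * r * (m * (5 * r) ^ j)"
    using S(3) card_UN_nbrs_le[OF fin, of E] sparseD[OF Suc.prems[of j] v S(1) S(3)] by simp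
  also have "\<dots> \<le> r * (m * (5 * r) ^ j) + 4 * r * (m * (5 * r) ^ j)"
    using mult_right_mono[OF r, of "m * (5 * r) ^ j"] by simp
  also have "\<dots> = m * (5 * r) ^ Suc j" by (simp add: algebra_simps)
  finally have "card (S \<union> ?N) \<le> m * (5 * r) ^ Suc j" .
  moreover have "conn E v (S \<union> ?N)"
    using S(1) fin finite_nbrs[OF E] by (intro conn_Un) auto
  moreover have "reach E v (Suc j) \<subseteq> S \<union> ?N" using S(2) by auto
  ultimately show ?case by blast
qed

lemma at_dist_subset_reach: "at_dist E W v j \<subseteq> reach E v j \<inter> W"
  by (auto simp: at_dist_def gdist_eq_enat_reach)

lemma reach_1: "reach E v 1 = nbrs E v" and reach_2: "reach E v 2 = (\<Union>u\<in>nbrs E v. nbrs E u)"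
  by (simp_all add: numeral_2_eq_2)

text \<open>This supplies the counts for \<open>two_phase_tau_le\<close> with
  \<open>s = r^2\<close>. For \<open>j \<ge> 3\<close> they follow from the growth of balls, for
  \<open>j \<le> 2\<close> from the degree threshold that defines \<open>H\<close>.\<close>

lemma sparse_tau_le:
  assumes E: "E \<subseteq> all_pairs n" and t: "t \<ge> 3" and A: "A \<ge> 1" and r: "r \<ge> 9"
    and sp: "\<And>i. i \<le> t \<Longrightarrow> sparse n E (A * r ^ 3 * (5 * r) ^ i) (4 * r * (A * r ^ 3 * (5 * r) ^ i))"
  shows "tau t n E \<le> t * ((t * 2 ^ t * (A * 5 ^ t) + 1) * r\<^sup>2)"
proof -
  define H where "H = {v. v < n \<and> r\<^sup>2 < deg E v}"
  \<comment> \<open>Room for a root and two sets of \<open>4 * A * r^2\<close> vertices in a set to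
    which sparsity applies; \<open>r \<ge> 9\<close> is used here.\<close>
  have size: "8 * A * r\<^sup>2 + 1 \<le> A * r ^ 3"
  proof -
    have "8 * A * r\<^sup>2 + 1 \<le> 9 * (A * r\<^sup>2)" using A r by simp
    also have "\<dots> \<le> r * (A * r\<^sup>2)" using r by (intro mult_right_mono) auto
    finally show ?thesis by (simp add: power2_eq_square power3_eq_cube algebra_simps)
  qed
  have sp0: "(\<Sum>u\<in>S. deg E u) \<le> 4 * A * r ^ 4"
    if "v < n" "conn E v S" "card S \<le> A * r ^ 3" for v S
    using sparseD[of n E "A * r ^ 3" "4 * r * (A * r ^ 3)", OF _ that] sp[of 0]
    by (simp add: eval_nat_numeral algebra_simps)
  \<comment> \<open>Members of \<open>H\<close> have degree at least \<open>r^2 + 1\<close>, so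
    \<open>4 * A * r^2\<close> of them would exceed the allowed degree sum
    \<open>4 * A * r ^ 4\<close>.\<close>
  have few: "card W < 4 * A * r\<^sup>2"
    if "v < n" "conn E v S" "card S \<le> A * r ^ 3" "W \<subseteq> S" "W \<subseteq> H" for v S W
  proof (rule ccontr)
    assume "\<not> card W < 4 * A * r\<^sup>2"
    hence "4 * A * r\<^sup>2 * (r\<^sup>2 + 1) \<le> card W * (r\<^sup>2 + 1)" by (intro mult_right_mono) auto
    also have "\<dots> = (\<Sum>u\<in>W. r\<^sup>2 + 1)" by simp
    also have "\<dots> \<le> (\<Sum>u\<in>W. deg E u)" using that(5) by (intro sum_mono) (auto simp: H_def)
    also have "\<dots> \<le> (\<Sum>u\<in>S. deg E u)"
      using that(4) conn_finite[OF that(2)] by (intro sum_mono2) auto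
    also have "\<dots> \<le> 4 * A * r ^ 4" using sp0 that by blast
    finally have "4 * A * r\<^sup>2 * (r\<^sup>2 + 1) \<le> 4 * A * r\<^sup>2 * r\<^sup>2" by (simp add: power4_eq_xxxx power2_eq_square)
    thus False using A r by simp
  qed
  have nbrs_H: "card (nbrs E v \<inter> H) \<le> 4 * A * r\<^sup>2" if v: "v < n" for v
  proof (rule ccontr)
    assume "\<not> card (nbrs E v \<inter> H) \<le> 4 * A * r\<^sup>2"
    \<comment> \<open>A subset of exactly the critical size is taken, because the full set may be
      too large for sparsity to apply.\<close>
    then obtain W where W: "W \<subseteq> nbrs E v \<inter> H" "card W = 4 * A * r\<^sup>2" "finite W"
      by (metis nat_le_linear obtain_subset_with_card_n)
    have "conn E v ({v} \<union> W)" using W by (intro conn_Un conn_root) auto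
    moreover have "card ({v} \<union> W) \<le> A * r ^ 3"
      using card_Un_le[of "{v}" W] W(2) size by simp
    ultimately show False using few[OF v, of "{v} \<union> W" W] W by auto
  qed
  have reach_2_H: "card (reach E v 2 \<inter> H) \<le> 4 * A * r\<^sup>2" if v: "v < n" for v
  proof (rule ccontr)
    assume "\<not> card (reach E v 2 \<inter> H) \<le> 4 * A * r\<^sup>2"
    then obtain W where W: "W \<subseteq> reach E v 2 \<inter> H" "card W = 4 * A * r\<^sup>2" "finite W"
      by (metis nat_le_linear obtain_subset_with_card_n)
    \<comment> \<open>One middle vertex per \<open>w\<close> suffices for connectedness; all
      neighbours of \<open>v\<close> might be too many.\<close>
    have "\<exists>g. \<forall>w\<in>W. g w \<in> nbrs E v \<and> w \<in> nbrs E (g w)"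
      by (intro bchoice) (use W(1) reach_2 in blast)
    then obtain g where g: "\<And>w. w \<in> W \<Longrightarrow> g w \<in> nbrs E v \<and> w \<in> nbrs E (g w)" by blast
    have "conn E v ({v} \<union> g ` W)" using W g by (intro conn_Un conn_root) auto
    hence "conn E v ({v} \<union> g ` W \<union> W)" using g by (intro conn_Un[OF W(3)]) auto
    moreover have "card ({v} \<union> g ` W \<union> W) \<le> A * r ^ 3"
      using card_Un_le[of "{v} \<union> g ` W" W] card_Un_le[of "{v}" "g ` W"]
        card_image_le[OF W(3), of g] W(2) size by simp
    ultimately show False using few[OF v, of "{v} \<union> g ` W \<union> W" W] W by auto
  qed
  \<comment> \<open>The neighbours in \<open>H\<close> form with \<open>v\<close> a small connected
    set, so sparsity bounds their degree sum; the others are at most \<open>r^2\<close> vertices of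
    degree at most \<open>r^2\<close>.\<close>
  have reach_2_low: "card (reach E v 2) \<le> 5 * A * r ^ 4" if v: "v < n" "v \<notin> H" for v
  proof -
    have fin: "finite (nbrs E v)" by (rule finite_nbrs[OF E])
    have "(\<Sum>u\<in>nbrs E v \<inter> H. deg E u) \<le> 4 * A * r ^ 4"
    proof -
      have "conn E v ({v} \<union> nbrs E v \<inter> H)" using fin by (intro conn_Un conn_root) auto
      moreover have "card ({v} \<union> nbrs E v \<inter> H) \<le> A * r ^ 3"
        using card_Un_le[of "{v}" "nbrs E v \<inter> H"] nbrs_H[OF v(1)] size by simp
      ultimately have "(\<Sum>u\<in>{v} \<union> nbrs E v \<inter> H. deg E u) \<le> 4 * A * r ^ 4"
        using sp0[OF v(1)] by blast
      moreover have "(\<Sum>u\<in>nbrs E v \<inter> H. deg E u) \<le> (\<Sum>u\<in>{v} \<union> nbrs E v \<inter> H. deg E u)"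
        using fin by (intro sum_mono2) auto
      ultimately show ?thesis by linarith
    qed
    moreover have "(\<Sum>u\<in>nbrs E v - H. deg E u) \<le> r ^ 4"
    proof -
      have "(\<Sum>u\<in>nbrs E v - H. deg E u) \<le> (\<Sum>u\<in>nbrs E v - H. r\<^sup>2)"
        using nbrs_subset[OF E, of v] by (intro sum_mono) (auto simp: H_def not_less)
      also have "\<dots> \<le> card (nbrs E v) * r\<^sup>2"
        using fin by (auto intro!: mult_right_mono card_mono)
      also have "\<dots> \<le> r\<^sup>2 * r\<^sup>2" using v by (intro mult_right_mono) (auto simp: H_def deg_def)
      finally show ?thesis by (simp add: power4_eq_xxxx power2_eq_square)
    qed
    moreover have "(\<Sum>u\<in>nbrs E v. deg E u) = (\<Sum>u\<in>nbrs E v \<inter> H. deg E u) + (\<Sum>u\<in>nbrs E v - H. deg E u)"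
      using fin by (rule sum.Int_Diff)
    moreover have "card (reach E v 2) \<le> (\<Sum>u\<in>nbrs E v. deg E u)"
      unfolding reach_2 by (rule card_UN_nbrs_le[OF fin])
    moreover have "r ^ 4 \<le> A * r ^ 4" using A by simp
    ultimately show ?thesis by linarith
  qed
  have finite_reach: "finite (reach E v j)" for v j
    by (induction j) (auto intro: finite_nbrs[OF E])
  have far: "card (reach E v j) \<le> A * 5 ^ t * (r\<^sup>2) ^ j" if v: "v < n" and j: "3 \<le> j" "j \<le> t" for v j
  proof -
    obtain S where S: "conn E v S" "reach E v j \<subseteq> S" "card S \<le> A * r ^ 3 * (5 * r) ^ j"
      using reach_conn_card[OF E v, of "A * r ^ 3" r j] sp A r j by auto
    have "card (reach E v j) \<le> A * r ^ 3 * (5 * r) ^ j"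
      using card_mono[OF conn_finite[OF S(1)] S(2)] S(3) by linarith
    also have "\<dots> = A * 5 ^ j * r ^ (3 + j)" by (simp add: power_mult_distrib power_add)
    \<comment> \<open>\<open>3 + j \<le> 2 * j\<close> is where \<open>j \<ge> 3\<close>
      enters.\<close>
    also have "\<dots> \<le> A * 5 ^ t * r ^ (2 * j)"
      using r j by (intro mult_mono power_increasing) auto
    finally show ?thesis by (simp add: power_mult)
  qed
  have A5: "5 * A \<le> A * 5 ^ t"
    using mult_left_mono[OF power_increasing[of 1 t "5::nat"], of A] t by simp
  have r4: "(r\<^sup>2)\<^sup>2 = r ^ 4" by (simp flip: power_mult)
  have r24: "r\<^sup>2 \<le> r ^ 4" using r by (intro power_increasing) auto
  show ?thesis
  proof (rule two_phase_tau_le[where H = H and A = "A * 5 ^ t"])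
    fix v j assume v: "v \<in> H" and j: "j \<in> {1..t}"
    have vn: "v < n" using v by (simp add: H_def)
    have le: "card (at_dist E H v j) \<le> card (reach E v j \<inter> H)"
      using finite_reach by (intro card_mono at_dist_subset_reach) auto
    consider "j = 1" | "j = 2" | "j \<ge> 3" using j by force
    thus "card (at_dist E H v j) \<le> A * 5 ^ t * (r\<^sup>2) ^ j"
    proof cases
      case 1
      have "4 * A * r\<^sup>2 \<le> A * 5 ^ t * r\<^sup>2" using A5 by (intro mult_right_mono) auto
      thus ?thesis using le nbrs_H[OF vn] unfolding 1 reach_1 power_one_right by linarith
    next
      case 2
      have "4 * A * r\<^sup>2 \<le> A * 5 ^ t * r ^ 4" using A5 by (intro mult_le_mono[OF _ r24]) linarith
      thus ?thesis using le reach_2_H[OF vn] unfolding 2 r4 by linarith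
    next
      case 3
      have "card (reach E v j \<inter> H) \<le> card (reach E v j)"
        using finite_reach by (intro card_mono) auto
      thus ?thesis using far[OF vn 3] j le by (meson atLeastAtMost_iff le_trans)
    qed
  next
    fix v j assume v: "v \<in> {..<n} - H" and j: "j \<in> {1..t}"
    hence vn: "v < n" "v \<notin> H" by auto
    have "card (at_dist E {..<n} v j) \<le> card (reach E v j \<inter> {..<n})"
      by (intro card_mono at_dist_subset_reach) auto
    also have "\<dots> \<le> card (reach E v j)"
      using finite_reach by (intro card_mono) auto
    finally have le: "card (at_dist E {..<n} v j) \<le> card (reach E v j)" .
    consider "j = 1" | "j = 2" | "j \<ge> 3" using j by force
    thus "card (at_dist E {..<n} v j) \<le> A * 5 ^ t * (r\<^sup>2) ^ j"
    proof cases
      case 1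
      have "1 * r\<^sup>2 \<le> A * 5 ^ t * r\<^sup>2" using A5 A by (intro mult_right_mono) auto
      moreover have "deg E v \<le> r\<^sup>2" using vn by (auto simp: H_def)
      ultimately show ?thesis using le unfolding 1 reach_1 deg_def power_one_right by linarith
    next
      case 2
      have "5 * A * r ^ 4 \<le> A * 5 ^ t * r ^ 4" using A5 by (intro mult_right_mono) auto
      thus ?thesis using le reach_2_low[OF vn] unfolding 2 r4 by linarith
    next
      case 3
      thus ?thesis using far[OF vn(1)] j le by (meson atLeastAtMost_iff le_trans)
    qed
  qed (use r in \<open>auto simp: H_def\<close>)
qed

section \<open>Random graphs are sparse\<close>

text \<open>A rooted plane tree is coded as a binary tree in first-child/next-sibling form: \<open>p\<close> is the
  parent of the root label and of all labels on the right spine.\<close>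

primrec tree_edges :: "nat \<Rightarrow> nat tree \<Rightarrow> nat set set" where
  "tree_edges p Leaf = {}"
| "tree_edges p (Node l a r) = insert {a, p} (tree_edges a l \<union> tree_edges p r)"

lemma finite_tree_edges [simp]: "finite (tree_edges p T)"
  by (induction T arbitrary: p) auto

lemma tree_edges_subset: "\<Union>(tree_edges p T) \<subseteq> insert p (set_tree T)"
  by (induction T arbitrary: p) fastforce+

text \<open>\<open>w\<close> becomes the first child of \<open>u\<close>. If \<open>u\<close> is the
  parent \<open>p\<close>, the old tree turns into the later siblings of \<open>w\<close>; otherwise
  the insertion continues in \<open>l\<close>, whose parent is \<open>a\<close>, or among the
  siblings in \<open>r\<close>.\<close>

lemma tree_add_leaf:
  assumes "u \<in> insert p (set_tree T)"
  shows "\<exists>T'. set_tree T' = insert w (set_tree T) \<and> size T' = Suc (size T) \<and>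
           tree_edges p T' = insert {w, u} (tree_edges p T)"
  using assms
proof (induction T arbitrary: p)
  case Leaf
  thus ?case by (intro exI[of _ "Node Leaf w Leaf"]) auto
next
  case (Node l a r)
  consider "u = p" | "u \<in> insert a (set_tree l)" | "u \<in> set_tree r" using Node.prems by auto
  thus ?case
  proof cases
    case 1
    thus ?thesis by (intro exI[of _ "Node Leaf w (Node l a r)"]) auto
  next
    case 2
    obtain l' where "set_tree l' = insert w (set_tree l)" "size l' = Suc (size l)"
      "tree_edges a l' = insert {w, u} (tree_edges a l)" using Node.IH(1)[OF 2] by blast
    thus ?thesis by (intro exI[of _ "Node l' a r"]) auto
  next
    case 3
    obtain r' where "set_tree r' = insert w (set_tree r)" "size r' = Suc (size r)"
      "tree_edges p r' = insert {w, u} (tree_edges p r)" using Node.IH(2)[of p] 3 by blast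
    thus ?thesis by (intro exI[of _ "Node l a r'"]) auto
  qed
qed

text \<open>Each vertex that joins the connected set is added as a leaf. The root \<open>v\<close>
  is not a node of \<open>T\<close>, hence the \<open>Suc\<close>. The last conjunct records that
  the tree edges are distinct: every new edge contains the new vertex.\<close>

lemma conn_tree:
  assumes "conn E v S"
  shows "\<exists>T. insert v (set_tree T) = S \<and> Suc (size T) = card S \<and>
           tree_edges v T \<subseteq> E \<and> card (tree_edges v T) = size T"
  using assms
proof (induction rule: conn.induct)
  case conn_root
  show ?case by (intro exI[of _ Leaf]) auto
next
  case (conn_insert S u w)
  then obtain T where T: "insert v (set_tree T) = S" "Suc (size T) = card S"
      "tree_edges v T \<subseteq> E" "card (tree_edges v T) = size T" by blast
  obtain T' where T': "set_tree T' = insert w (set_tree T)" "size T' = Suc (size T)"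
      "tree_edges v T' = insert {w, u} (tree_edges v T)"
    using tree_add_leaf[of u v T w] conn_insert.hyps T by blast
  have "{w, u} \<notin> tree_edges v T"
    using tree_edges_subset[of v T] T(1) conn_insert.hyps by blast
  thus ?case using T T' conn_insert.hyps conn_finite[of E v S]
    by (intro exI[of _ T']) auto
qed

section \<open>Edges that meet a connected set, and witnesses of density\<close>

text \<open>Double counting: an edge contains at most two vertices of \<open>S\<close>.\<close>

lemma sum_deg_le_incident:
  assumes E: "E \<subseteq> all_pairs n" and S: "finite S"
  shows "(\<Sum>u\<in>S. deg E u) \<le> 2 * card {e \<in> E. e \<inter> S \<noteq> {}}"
proof -
  let ?I = "{e \<in> E. e \<inter> S \<noteq> {}}"
  have finE: "finite E" using finite_subset[OF E] by simp
  have "deg E u \<le> (\<Sum>e\<in>?I. if u \<in> e then 1 else 0)" if "u \<in> S" for u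
  proof -
    have "deg E u = card ((\<lambda>w. {w, u}) ` nbrs E u)"
      unfolding deg_def by (rule card_image[symmetric]) (auto simp: inj_on_def doubleton_eq_iff)
    also have "\<dots> \<le> card {e \<in> ?I. u \<in> e}"
      using finE that by (intro card_mono) (auto simp: nbrs_def)
    also have "\<dots> = (\<Sum>e\<in>?I. if u \<in> e then 1 else 0)"
      using finE by (simp add: sum.If_cases Int_def)
    finally show ?thesis .
  qed
  hence "(\<Sum>u\<in>S. deg E u) \<le> (\<Sum>u\<in>S. \<Sum>e\<in>?I. if u \<in> e then 1 else 0)" by (rule sum_mono)
  also have "\<dots> = (\<Sum>e\<in>?I. \<Sum>u\<in>S. if u \<in> e then 1 else 0)" by (rule sum.swap)
  also have "\<dots> \<le> (\<Sum>e\<in>?I. 2)"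
  proof (rule sum_mono)
    fix e assume "e \<in> ?I"
    hence e: "card e = 2" using E by (auto simp: all_pairs_def)
    have "(\<Sum>u\<in>S. if u \<in> e then 1 else 0) = card (S \<inter> e)" using S by (simp add: sum.If_cases Int_def)
    also have "\<dots> \<le> 2" using e card_mono[of e "S \<inter> e"] by (simp add: card_ge_0_finite)
    finally show "(\<Sum>u\<in>S. if u \<in> e then 1 else 0) \<le> (2::nat)" .
  qed
  finally show ?thesis by simp
qed

lemma card_incident_pairs:
  assumes "finite S"
  shows "card {e \<in> all_pairs n. e \<inter> S \<noteq> {}} \<le> card S * n"
proof -
  have "{e \<in> all_pairs n. e \<inter> S \<noteq> {}} \<subseteq> (\<lambda>(u, w). {u, w}) ` (S \<times> {..<n})"
  proof
    fix e assume "e \<in> {e \<in> all_pairs n. e \<inter> S \<noteq> {}}"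
    then obtain u where e: "e \<in> all_pairs n" "u \<in> e" "u \<in> S" by blast
    then obtain a b where "e = {a, b}" by (auto simp: all_pairs_def card_2_iff)
    thus "e \<in> (\<lambda>(u, w). {u, w}) ` (S \<times> {..<n})"
      using e by (cases "u = a") (auto simp: all_pairs_def insert_commute image_iff)
  qed
  hence "card {e \<in> all_pairs n. e \<inter> S \<noteq> {}} \<le> card ((\<lambda>(u, w). {u, w}) ` (S \<times> {..<n}))"
    using assms by (intro card_mono) auto
  also have "\<dots> \<le> card (S \<times> {..<n})" using assms by (intro card_image_le) auto
  finally show ?thesis by (simp only: card_cartesian_product card_lessThan)
qed

text \<open>Repeated labels are allowed: this only enlarges a union bound and lets the weights be
  summed by splitting at the root. The strict inequality leaves room for the root
  \<open>v\<close>.\<close>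

definition trees_upto :: "nat \<Rightarrow> nat \<Rightarrow> nat tree set" where
  "trees_upto n m = {T. size T < m \<and> set_tree T \<subseteq> {..<n}}"

text \<open>The surplus edges of a dense set. They avoid the tree so that the probabilities of tree
  and surplus multiply.\<close>

definition edge_choices :: "nat \<Rightarrow> nat \<Rightarrow> nat \<Rightarrow> nat tree \<Rightarrow> nat set set set" where
  "edge_choices n q v T = {F. F \<subseteq> {e \<in> all_pairs n. e \<inter> insert v (set_tree T) \<noteq> {}} \<and>
     card F = q \<and> F \<inter> tree_edges v T = {}}"

text \<open>A degree sum above \<open>2 * (q + m)\<close> means more than \<open>q + m\<close> edges
  meeting \<open>S\<close>; a spanning tree takes fewer than \<open>m\<close> of them and leaves at
  least \<open>q\<close>.\<close>

lemma not_sparse_witness: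
  assumes E: "E \<subseteq> all_pairs n" and ns: "\<not> sparse n E m (2 * (q + m))"
  shows "\<exists>v<n. \<exists>T\<in>trees_upto n m. \<exists>F\<in>edge_choices n q v T.
           card (tree_edges v T) = size T \<and> tree_edges v T \<union> F \<subseteq> E"
proof -
  obtain v S where v: "v < n" and S: "conn E v S" "card S \<le> m" "(\<Sum>u\<in>S. deg E u) > 2 * (q + m)"
    using ns by (auto simp: sparse_def not_le)
  have finS: "finite S" using conn_finite[OF S(1)] .
  have Sn: "S \<subseteq> {..<n}" using S(1)
  proof (induction rule: conn.induct)
    case (conn_insert S u w)
    thus ?case using E by (auto simp: all_pairs_def)
  qed (use v in auto)
  obtain T where T: "insert v (set_tree T) = S" "Suc (size T) = card S"
      "tree_edges v T \<subseteq> E" "card (tree_edges v T) = size T"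
    using conn_tree[OF S(1)] by blast
  define I where "I = {e \<in> E. e \<inter> S \<noteq> {}}"
  have "(\<Sum>u\<in>S. deg E u) \<le> 2 * card I"
    unfolding I_def by (rule sum_deg_le_incident[OF E finS])
  hence "2 * (q + m) < 2 * card I" using S(3) by (rule less_le_trans[rotated])
  hence "q + m < card I" unfolding nat_mult_less_cancel_disj by blast
  moreover have "card I - card (tree_edges v T) \<le> card (I - tree_edges v T)"
    by (rule diff_card_le_card_Diff) simp
  ultimately have "q \<le> card (I - tree_edges v T)" using T(2,4) S(2) by linarith
  then obtain F where F: "F \<subseteq> I - tree_edges v T" "card F = q"
    using obtain_subset_with_card_n by metis
  have "T \<in> trees_upto n m" using T S(2) Sn by (auto simp: trees_upto_def)
  moreover have "F \<in> edge_choices n q v T" using F T(1) E by (auto simp: edge_choices_def I_def)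
  ultimately show ?thesis using v T F unfolding I_def by blast
qed

section \<open>Weighted counting of labelled trees\<close>

text \<open>With \<open>g\<^sub>h\<close> the sum over the trees of height at most \<open>h\<close>, splitting at the root gives
  \<open>g\<^sub>h\<^sub>+\<^sub>1 = 1 + |V| x g\<^sub>h\<^sup>2\<close>, which preserves \<open>g\<^sub>h \<le> 2\<close>.\<close>

lemma sum_tree_weights_height:
  fixes x :: real
  assumes V: "finite V" and x: "0 \<le> x" "card V * x \<le> 1 / 4"
  shows "finite {T. height T \<le> h \<and> set_tree T \<subseteq> V} \<and>
         (\<Sum>T | height T \<le> h \<and> set_tree T \<subseteq> V. x ^ size T) \<le> 2"
proof (induction h)
  case 0
  have "{T. height T \<le> 0 \<and> set_tree T \<subseteq> V} = {Leaf}" by auto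
  thus ?case by simp
next
  case (Suc h)
  let ?S = "{T. height T \<le> h \<and> set_tree T \<subseteq> V}"
  let ?f = "\<lambda>(l, a, r). Node l a r"
  let ?g = "\<Sum>T\<in>?S. x ^ size T"
  have eq: "{T. height T \<le> Suc h \<and> set_tree T \<subseteq> V} = insert Leaf (?f ` (?S \<times> V \<times> ?S))"
  proof (intro set_eqI iffI)
    fix T assume "T \<in> {T. height T \<le> Suc h \<and> set_tree T \<subseteq> V}"
    thus "T \<in> insert Leaf (?f ` (?S \<times> V \<times> ?S))" by (cases T) (auto simp: image_iff)
  qed auto
  have fin: "finite ?S" using Suc by blast
  have "(\<Sum>T | height T \<le> Suc h \<and> set_tree T \<subseteq> V. x ^ size T)
      = 1 + (\<Sum>T\<in>?f ` (?S \<times> V \<times> ?S). x ^ size T)"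
    unfolding eq using fin V by (subst sum.insert) auto
  also have "(\<Sum>T\<in>?f ` (?S \<times> V \<times> ?S). x ^ size T) = (\<Sum>(l, a, r)\<in>?S \<times> V \<times> ?S. x ^ size l * (x * x ^ size r))"
    by (subst sum.reindex) (auto simp: inj_on_def power_add intro!: sum.cong)
  also have "\<dots> = (\<Sum>l\<in>?S. \<Sum>a\<in>V. \<Sum>r\<in>?S. x ^ size l * (x * x ^ size r))"
    by (simp add: sum.cartesian_product case_prod_unfold del: sum_constant)
  also have "\<dots> = card V * x * (?g * ?g)"
    by (simp add: sum_distrib_left[symmetric] sum_distrib_right[symmetric] algebra_simps)
  also have "\<dots> \<le> 1 / 4 * (2 * 2)"
    using Suc x by (intro mult_mono sum_nonneg mult_nonneg_nonneg) auto
  finally show ?case using eq fin V by simp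
qed

lemma trees_upto_subset: "trees_upto n m \<subseteq> {T. height T \<le> m \<and> set_tree T \<subseteq> {..<n}}"
proof
  fix T assume "T \<in> trees_upto n m"
  thus "T \<in> {T. height T \<le> m \<and> set_tree T \<subseteq> {..<n}}"
    using height_le_size_tree[of T] by (simp add: trees_upto_def)
qed

lemma finite_trees_upto: "finite (trees_upto n m)"
  using finite_subset[OF trees_upto_subset] sum_tree_weights_height[of "{..<n}" 0 m] by simp

text \<open>The weight \<open>p / K\<close> satisfies the smallness condition of
  \<open>sum_tree_weights_height\<close>; returning to \<open>p\<close> costs a factor
  \<open>K\<close> per node, at most \<open>K ^ m\<close>.\<close>

lemma sum_tree_weights:
  fixes p K :: real
  assumes p: "0 \<le> p" and K: "K \<ge> 1" "4 * n * p \<le> K"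
  shows "(\<Sum>T\<in>trees_upto n m. p ^ size T) \<le> 2 * K ^ m"
proof -
  let ?S = "{T. height T \<le> m \<and> set_tree T \<subseteq> {..<n}}"
  have sub: "trees_upto n m \<subseteq> ?S" by (rule trees_upto_subset)
  have x: "card {..<n} * (p / K) \<le> 1 / 4" using K by (simp add: field_simps)
  have w: "finite ?S" "(\<Sum>T\<in>?S. (p / K) ^ size T) \<le> 2"
    using sum_tree_weights_height[of "{..<n}" "p / K" m] x p K by auto
  have "(\<Sum>T\<in>trees_upto n m. p ^ size T) \<le> (\<Sum>T\<in>trees_upto n m. K ^ m * (p / K) ^ size T)"
  proof (rule sum_mono)
    fix T assume "T \<in> trees_upto n m"
    hence "K ^ size T \<le> K ^ m" using K by (intro power_increasing) (auto simp: trees_upto_def)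
    hence "K ^ size T * (p / K) ^ size T \<le> K ^ m * (p / K) ^ size T"
      using p K by (intro mult_right_mono) auto
    thus "p ^ size T \<le> K ^ m * (p / K) ^ size T"
      using K by (simp add: power_divide)
  qed
  also have "\<dots> = K ^ m * (\<Sum>T\<in>trees_upto n m. (p / K) ^ size T)" by (simp add: sum_distrib_left)
  also have "\<dots> \<le> K ^ m * (\<Sum>T\<in>?S. (p / K) ^ size T)"
    using K p w sub by (intro mult_left_mono sum_mono2) auto
  also have "\<dots> \<le> K ^ m * 2" using w K by (intro mult_left_mono) auto
  finally show ?thesis by simp
qed

section \<open>The union bound for the failure of sparsity\<close>

lemma set_pmf_gnp: "E \<in> set_pmf (gnp n p) \<Longrightarrow> E \<subseteq> all_pairs n"
  by (auto simp: gnp_def)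

lemma prob_gnp_superset:
  assumes "F \<subseteq> all_pairs n" "0 \<le> p" "p \<le> 1"
  shows "measure_pmf.prob (gnp n p) {E. F \<subseteq> E} = p ^ card F"
proof -
  have "measure_pmf.prob (gnp n p) {E. F \<subseteq> E} =
     measure_pmf.prob (Pi_pmf (all_pairs n) False (\<lambda>_. bernoulli_pmf p))
       (Pi (all_pairs n) (\<lambda>e. if e \<in> F then {True} else UNIV))"
    unfolding gnp_def measure_map_pmf
    using assms(1) by (intro arg_cong2[where f = measure_pmf.prob] refl) (fastforce simp: Pi_def)
  also have "\<dots> = (\<Prod>e\<in>all_pairs n. if e \<in> F then p else 1)"
    using assms by (subst measure_Pi_pmf_Pi) (auto intro!: prod.cong simp: measure_pmf_single)
  also have "\<dots> = (\<Prod>e\<in>F. p)"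
    using assms(1) by (intro prod.mono_neutral_cong_right) auto
  finally show ?thesis by simp
qed

text \<open>Union bound over root, tree and surplus: a witness has probability at most
  \<open>p ^ size T * p ^ q\<close>, the tree weights sum to at most \<open>2 * K ^ m\<close>, and
  each tree admits at most \<open>m * n choose q\<close> surplus sets.\<close>

lemma prob_not_sparse:
  fixes p K :: real
  assumes p: "0 \<le> p" "p \<le> 1" and K: "K \<ge> 1" "4 * n * p \<le> K"
  shows "measure_pmf.prob (gnp n p) {E. \<not> sparse n E m (2 * (q + m))}
           \<le> n * (2 * K ^ m * ((m * n choose q) * p ^ q))"
proof -
  let ?P = "measure_pmf.prob (gnp n p)"
  \<comment> \<open>The condition on \<open>card\<close> empties the event for trees whose repeated
    labels make edges collapse; for those the bound \<open>p ^ size T\<close> could fail.\<close>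
  define X where "X v T F = {E. E \<subseteq> all_pairs n \<and> card (tree_edges v T) = size T \<and>
                                 tree_edges v T \<union> F \<subseteq> E}" for v T F
  have X: "?P (X v T F) \<le> p ^ size T * p ^ q" if F: "F \<in> edge_choices n q v T" for v T F
  proof (cases "card (tree_edges v T) = size T \<and> tree_edges v T \<subseteq> all_pairs n")
    case True
    have F': "F \<subseteq> all_pairs n" "card F = q" "F \<inter> tree_edges v T = {}"
      using F by (auto simp: edge_choices_def)
    have "finite F" using finite_subset[OF F'(1)] by simp
    hence "card (tree_edges v T \<union> F) = size T + q"
      using True F' by (subst card_Un_disjoint) auto
    moreover have "?P (X v T F) \<le> ?P {E. tree_edges v T \<union> F \<subseteq> E}"
      by (intro measure_pmf.finite_measure_mono) (auto simp: X_def)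
    ultimately show ?thesis using prob_gnp_superset[of "tree_edges v T \<union> F" n p] True F' p
      by (simp add: power_add)
  next
    case False
    hence "X v T F = {}" by (auto simp: X_def)
    thus ?thesis using p by simp
  qed
  have finF: "finite (edge_choices n q v T)" for v T
    by (rule finite_subset[of _ "Pow (all_pairs n)"]) (auto simp: edge_choices_def)
  have cardF: "card (edge_choices n q v T) \<le> (m * n choose q)" if "T \<in> trees_upto n m" for v T
  proof -
    let ?A = "{e \<in> all_pairs n. e \<inter> insert v (set_tree T) \<noteq> {}}"
    have "card (insert v (set_tree T)) \<le> Suc (card (set_tree T))" by (rule card_insert_le_m1) auto
    also have "card (set_tree T) \<le> size T"
      by (metis card_length length_inorder set_inorder)
    finally have "card (insert v (set_tree T)) \<le> m" using that by (auto simp: trees_upto_def)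
    hence "card ?A \<le> m * n"
      using card_incident_pairs[of "insert v (set_tree T)" n] mult_right_mono[of _ m n]
      by (meson finite_insert finite_set_tree le_trans zero_le)
    hence *: "(card ?A choose q) \<le> (m * n choose q)" by (rule binomial_right_mono)
    have "card (edge_choices n q v T) \<le> card {F. F \<subseteq> ?A \<and> card F = q}"
      by (intro card_mono) (auto simp: edge_choices_def)
    also have "\<dots> = (card ?A choose q)" by (rule n_subsets) auto
    finally show ?thesis using * by linarith
  qed
  have "?P {E. \<not> sparse n E m (2 * (q + m))}
      \<le> ?P (\<Union>v\<in>{..<n}. \<Union>T\<in>trees_upto n m. \<Union>F\<in>edge_choices n q v T. X v T F)"
  \<comment> \<open>The witness needs \<open>E \<subseteq> all_pairs n\<close>, which is known on
    the support only.\<close>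
  proof (rule measure_pmf.finite_measure_mono_AE)
    show "AE E in gnp n p. E \<in> {E. \<not> sparse n E m (2 * (q + m))} \<longrightarrow>
        E \<in> (\<Union>v\<in>{..<n}. \<Union>T\<in>trees_upto n m. \<Union>F\<in>edge_choices n q v T. X v T F)"
      unfolding AE_measure_pmf_iff
    proof (intro ballI impI)
      fix E assume E: "E \<in> set_pmf (gnp n p)" "E \<in> {E. \<not> sparse n E m (2 * (q + m))}"
      show "E \<in> (\<Union>v\<in>{..<n}. \<Union>T\<in>trees_upto n m. \<Union>F\<in>edge_choices n q v T. X v T F)"
      proof -
        have "\<not> sparse n E m (2 * (q + m))" using E(2) by simp
        from not_sparse_witness[OF set_pmf_gnp[OF E(1)] this] obtain v T F
          where w: "v < n" "T \<in> trees_upto n m" "F \<in> edge_choices n q v T"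
            "card (tree_edges v T) = size T" "tree_edges v T \<union> F \<subseteq> E" by blast
        hence "E \<in> X v T F" unfolding X_def using set_pmf_gnp[OF E(1)] by simp
        thus ?thesis using w(1-3) by (intro UN_I[of v] UN_I[of T] UN_I[of F]) auto
      qed
    qed
  qed auto
  also have "\<dots> \<le> (\<Sum>v<n. ?P (\<Union>T\<in>trees_upto n m. \<Union>F\<in>edge_choices n q v T. X v T F))"
    by (intro measure_pmf.finite_measure_subadditive_finite) auto
  also have "\<dots> \<le> (\<Sum>v<n. \<Sum>T\<in>trees_upto n m. ?P (\<Union>F\<in>edge_choices n q v T. X v T F))"
    by (intro sum_mono measure_pmf.finite_measure_subadditive_finite finite_trees_upto) auto
  also have "\<dots> \<le> (\<Sum>v<n. \<Sum>T\<in>trees_upto n m. \<Sum>F\<in>edge_choices n q v T. ?P (X v T F))"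
    by (intro sum_mono measure_pmf.finite_measure_subadditive_finite finF) auto
  also have "\<dots> \<le> (\<Sum>v<n. \<Sum>T\<in>trees_upto n m. \<Sum>F\<in>edge_choices n q v T. p ^ size T * p ^ q)"
    by (intro sum_mono X)
  also have "\<dots> = (\<Sum>v<n. \<Sum>T\<in>trees_upto n m. p ^ size T * (card (edge_choices n q v T) * p ^ q))"
    by (simp add: algebra_simps)
  also have "\<dots> \<le> (\<Sum>v<n. \<Sum>T\<in>trees_upto n m. p ^ size T * ((m * n choose q) * p ^ q))"
    using p cardF by (intro sum_mono mult_left_mono mult_right_mono) auto
  also have "\<dots> = n * ((\<Sum>T\<in>trees_upto n m. p ^ size T) * ((m * n choose q) * p ^ q))"
    by (simp add: sum_distrib_right)
  also have "\<dots> \<le> n * (2 * K ^ m * ((m * n choose q) * p ^ q))"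
    using p by (intro mult_left_mono mult_right_mono sum_tree_weights K) auto
  finally show ?thesis .
qed

section \<open>Numerical estimates and the maximum degree\<close>

text \<open>\<open>q ^ q / q!\<close> is one term of the series for \<open>exp q\<close>.\<close>

lemma power_self_le_exp_fact: "real q ^ q \<le> exp (real q) * fact q"
proof -
  have "(\<Sum>i\<in>{q}. real q ^ i /\<^sub>R fact i) \<le> (\<Sum>i. real q ^ i /\<^sub>R fact i)"
    by (intro sum_le_suminf summable_exp_generic) auto
  thus ?thesis by (simp add: exp_def field_simps)
qed

text \<open>The estimate \<open>(N choose q) \<le> (e * N / q) ^ q\<close> with
  \<open>N = m * n\<close> and \<open>q = r * m\<close>; then \<open>m\<close> and \<open>n\<close>
  cancel.\<close>

lemma binomial_power_le:
  fixes c :: real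
  assumes "c > 0" "n \<ge> 1" "m \<ge> 1" "r \<ge> 1"
  shows "(m * n choose (r * m)) * (c / n) ^ (r * m) \<le> (exp 1 * c / r) ^ (r * m)"
proof -
  define q where "q = r * m"
  have q: "q \<ge> 1" using assms by (auto simp: q_def)
  have "real ((m * n choose q) * fact q) \<le> real ((m * n) ^ q)"
    by (intro of_nat_mono binomial_fact_pow)
  hence "(m * n choose q) \<le> (real m * n) ^ q / fact q"
    by (simp add: field_simps)
  also have "\<dots> \<le> (real m * n) ^ q * (exp (real q) / real q ^ q)"
  proof -
    have "1 / fact q \<le> exp (real q) / real q ^ q"
      using power_self_le_exp_fact[of q] q by (simp add: field_simps)
    thus ?thesis using mult_left_mono[of "1 / fact q" "exp (real q) / real q ^ q" "(real m * n) ^ q"] by simp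
  qed
  finally have "(m * n choose q) * (c / n) ^ q \<le> (real m * n) ^ q * (exp (real q) / real q ^ q) * (c / n) ^ q"
    using assms by (intro mult_right_mono) auto
  also have "exp (real q) = exp 1 ^ q" by (metis exp_of_nat_mult mult.right_neutral)
  also have "(real m * n) ^ q * (exp 1 ^ q / real q ^ q) * (c / n) ^ q = (real m * n * (exp 1 / q) * (c / n)) ^ q"
    by (simp only: power_mult_distrib power_divide)
  also have "real m * n * (exp 1 / q) * (c / n) = exp 1 * c / r"
    using assms by (simp add: q_def field_simps)
  finally show ?thesis by (simp add: q_def)
qed

lemma sparse_mono: "sparse n E m q \<Longrightarrow> q \<le> q' \<Longrightarrow> sparse n E m q'"
  unfolding sparse_def by (meson le_trans)

text \<open>The tree factor \<open>K ^ m\<close> is absorbed into \<open>K ^ (r * m)\<close>, so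
  each of the \<open>r * m\<close> surplus edges contributes \<open>x / r\<close> with
  \<open>x\<close> depending on \<open>c\<close> only. As \<open>r * m \<ge> 257 * r ^ 4\<close>,
  this beats \<open>n \<le> r ^ (256 * r ^ 4)\<close> and leaves
  \<open>(x ^ 257 / r) ^ (r ^ 4)\<close>.\<close>

lemma prob_not_sparse_le:
  fixes c :: real
  defines "x \<equiv> max 1 (4 * c) * (exp 1 * c)"
  assumes c: "c > 0" "c \<le> n" and n: "n \<ge> 1" "n \<le> r ^ (256 * r ^ 4)"
    and r: "r \<ge> 1" "x \<le> r" "x ^ 257 \<le> r" and m: "m \<ge> 257 * r ^ 3"
  shows "measure_pmf.prob (gnp n (c / n)) {E. \<not> sparse n E m (4 * r * m)} \<le> 2 * x ^ 257 / r"
proof -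
  let ?P = "measure_pmf.prob (gnp n (c / n))"
  define K where "K = max 1 (4 * c)"
  have K: "K \<ge> 1" by (simp add: K_def)
  have x: "x = K * (exp 1 * c)" "x > 0" using c K by (auto simp: x_def K_def)
  have "257 * r ^ 3 \<ge> 1" using r(1) by simp
  hence m1: "m \<ge> 1" using m by linarith
  have "?P {E. \<not> sparse n E m (4 * r * m)} \<le> ?P {E. \<not> sparse n E m (2 * (r * m + m))}"
  proof (intro measure_pmf.finite_measure_mono)
    have "m \<le> r * m" using r(1) by simp
    hence "2 * (r * m + m) \<le> 4 * r * m" by (simp add: algebra_simps)
    thus "{E. \<not> sparse n E m (4 * r * m)} \<subseteq> {E. \<not> sparse n E m (2 * (r * m + m))}"
      using sparse_mono by blast
  qed auto
  also have "\<dots> \<le> n * (2 * K ^ m * ((m * n choose (r * m)) * (c / n) ^ (r * m)))"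
    using c n K by (intro prob_not_sparse) (auto simp: K_def)
  also have "\<dots> \<le> n * (2 * K ^ m * (exp 1 * c / r) ^ (r * m))"
    using binomial_power_le[OF c(1) n(1) m1 r(1)] K by (intro mult_left_mono) auto
  also have "\<dots> \<le> n * (2 * K ^ (r * m) * (exp 1 * c / r) ^ (r * m))"
    using r(1) K c by (intro mult_left_mono mult_right_mono power_increasing) auto
  also have "\<dots> = n * (2 * (x / r) ^ (r * m))"
    by (simp add: x(1) power_mult_distrib power_divide)
  also have "\<dots> \<le> n * (2 * (x / r) ^ (257 * r ^ 4))"
  proof (intro mult_left_mono power_decreasing)
    have "r * (257 * r ^ 3) \<le> r * m" using m by (rule mult_left_mono) simp
    thus "257 * r ^ 4 \<le> r * m" by (simp add: eval_nat_numeral algebra_simps)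
  qed (use r x in auto)
  also have "\<dots> \<le> real r ^ (256 * r ^ 4) * (2 * (x / r) ^ (257 * r ^ 4))"
  proof (intro mult_right_mono)
    have "real n \<le> real (r ^ (256 * r ^ 4))" using n(2) by (rule of_nat_mono)
    thus "real n \<le> real r ^ (256 * r ^ 4)" by simp
  qed (use x in auto)
  also have "\<dots> = 2 * (real r ^ 256 * (x / r) ^ 257) ^ r ^ 4"
    by (simp only: power_mult power_mult_distrib mult.left_commute)
  also have "real r ^ 256 * (x / r) ^ 257 = x ^ 257 / r"
  proof -
    have "real r ^ 257 = real r ^ 256 * r" using power_Suc2[of "real r" 256] by simp
    thus ?thesis using r(1) by (simp add: power_divide del: power_Suc)
  qed
  \<comment> \<open>The base is at most 1, and its first power already tends to 0.\<close>
  also have "2 * (x ^ 257 / r) ^ r ^ 4 \<le> 2 * (x ^ 257 / r) ^ 1"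
    using r x by (intro mult_left_mono power_decreasing) auto
  finally show ?thesis by simp
qed

section \<open>The lower tail of the maximum degree\<close>

text \<open>Intersecting with the supports makes both factors countable.\<close>

lemma prob_pair_pmf_Times:
  "measure_pmf.prob (pair_pmf p q) (A \<times> B) = measure_pmf.prob p A * measure_pmf.prob q B"
proof -
  have "measure_pmf.prob (pair_pmf p q) (A \<times> B)
      = measure_pmf.prob (pair_pmf p q) (A \<times> B \<inter> set_pmf (pair_pmf p q))"
    by (simp only: measure_Int_set_pmf)
  also have "A \<times> B \<inter> set_pmf (pair_pmf p q) = (A \<inter> set_pmf p) \<times> (B \<inter> set_pmf q)" by auto
  also have "measure_pmf.prob (pair_pmf p q) \<dots>
      = measure_pmf.prob p (A \<inter> set_pmf p) * measure_pmf.prob q (B \<inter> set_pmf q)"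
    by (rule measure_pmf_prob_product) (auto intro: countable_Int2)
  finally show ?thesis by (simp only: measure_Int_set_pmf)
qed

text \<open>Splitting off one block factorises the product measure, so the numbers of true
  coordinates in disjoint blocks are independent binomials.\<close>

lemma prob_all_blocks_less:
  fixes C :: "'a \<Rightarrow> 'b set"
  assumes "finite I" "\<And>i. i \<in> I \<Longrightarrow> finite (C i) \<and> card (C i) = N"
    and "disjoint_family_on C I" and p: "p \<in> {0..1}"
  shows "measure_pmf.prob (Pi_pmf (\<Union>i\<in>I. C i) False (\<lambda>_. bernoulli_pmf p))
           {f. \<forall>i\<in>I. card {x \<in> C i. f x} < M} = measure_pmf.prob (binomial_pmf N p) {..<M} ^ card I"
  using assms(1-3)
proof (induction I rule: finite_induct)
  case (insert i I)
  let ?U = "\<Union>j\<in>I. C j"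
  let ?h = "\<lambda>(f, g) x. if x \<in> C i then f x else g x"
  let ?Q = "\<lambda>A. Pi_pmf A False (\<lambda>_. bernoulli_pmf p)"
  have disj: "C i \<inter> C j = {}" if "j \<in> I" for j
    using insert.prems(2) insert.hyps that by (auto simp: disjoint_family_on_def)
  have "?Q (\<Union>j\<in>insert i I. C j) = map_pmf ?h (pair_pmf (?Q (C i)) (?Q ?U))"
    using insert disj by (subst UN_insert, subst Pi_pmf_union) auto
  moreover have "?h -` {f. \<forall>j\<in>insert i I. card {x \<in> C j. f x} < M} =
      {f. card {x \<in> C i. f x} < M} \<times> {g. \<forall>j\<in>I. card {x \<in> C j. g x} < M}"
  proof -
    have 1: "{x \<in> C i. if x \<in> C i then f x else g x} = {x \<in> C i. f x}" for f g :: "'b \<Rightarrow> bool"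
      by auto
    have 2: "{x \<in> C j. if x \<in> C i then f x else g x} = {x \<in> C j. g x}"
      if "j \<in> I" for f g :: "'b \<Rightarrow> bool" and j
      using disj[OF that] by auto
    have "(f, g) \<in> ?h -` {f. \<forall>j\<in>insert i I. card {x \<in> C j. f x} < M} \<longleftrightarrow>
        card {x \<in> C i. f x} < M \<and> (\<forall>j\<in>I. card {x \<in> C j. g x} < M)" for f g
    proof -
      have "(\<forall>j\<in>I. card {x \<in> C j. if x \<in> C i then f x else g x} < M) \<longleftrightarrow>
          (\<forall>j\<in>I. card {x \<in> C j. g x} < M)"
        by (intro ball_cong refl) (simp only: 2)
      moreover have "(\<forall>j\<in>insert i I. R j) \<longleftrightarrow> R i \<and> (\<forall>j\<in>I. R j)" for R by blast
      ultimately show ?thesis by (simp only: vimage_eq mem_Collect_eq prod.case 1)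
    qed
    from this[of "fst z" "snd z" for z] show ?thesis
      by (intro set_eqI) (simp only: mem_Times_iff mem_Collect_eq prod.collapse)
  qed
  ultimately have "measure_pmf.prob (?Q (\<Union>j\<in>insert i I. C j)) {f. \<forall>j\<in>insert i I. card {x \<in> C j. f x} < M}
    = measure_pmf.prob (pair_pmf (?Q (C i)) (?Q ?U))
       ({f. card {x \<in> C i. f x} < M} \<times> {g. \<forall>j\<in>I. card {x \<in> C j. g x} < M})"
    by simp
  also have "\<dots> = measure_pmf.prob (?Q (C i)) {f. card {x \<in> C i. f x} < M} *
       measure_pmf.prob (?Q ?U) {g. \<forall>j\<in>I. card {x \<in> C j. g x} < M}"
    by (rule prob_pair_pmf_Times)
  also have "measure_pmf.prob (?Q (C i)) {f. card {x \<in> C i. f x} < M}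
     = measure_pmf.prob (binomial_pmf N p) {..<M}"
    using insert.prems(1)[of i] p
    by (subst binomial_pmf_altdef'[where A = "C i" and dflt = False]) (auto simp: vimage_def)
  also have "measure_pmf.prob (?Q ?U) {g. \<forall>j\<in>I. card {x \<in> C j. g x} < M}
     = measure_pmf.prob (binomial_pmf N p) {..<M} ^ card I"
    using insert.prems by (intro insert.IH) (auto simp: disjoint_family_on_def)
  finally show ?case using insert.hyps by simp
qed simp

text \<open>Only edges between \<open>{..<h}\<close> and \<open>{h..<n}\<close> are used, because the degrees of the vertices
  below \<open>h\<close> into \<open>{h..<n}\<close> are independent.\<close>

lemma prob_max_degree_less:
  assumes h: "h \<le> n" and p: "p \<in> {0..1}"
  shows "measure_pmf.prob (gnp n p) {E. max_degree n E < M}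
           \<le> measure_pmf.prob (binomial_pmf (n - h) p) {..<M} ^ h"
proof -
  define C where "C v = (\<lambda>w. {w, v}) ` {h..<n}" for v :: nat
  let ?U = "\<Union>v\<in>{..<h}. C v"
  let ?Q = "\<lambda>A. Pi_pmf A False (\<lambda>_. bernoulli_pmf p)"
  have cardC: "card (C v) = n - h" for v
    unfolding C_def by (subst card_image) (auto simp: inj_on_def doubleton_eq_iff)
  have finC: "finite (C v)" for v by (simp add: C_def)
  have sub: "?U \<subseteq> all_pairs n" using h by (auto simp: C_def all_pairs_def card_insert_if)
  have disj: "disjoint_family_on C {..<h}"
    by (auto simp: disjoint_family_on_def C_def doubleton_eq_iff)
  have "measure_pmf.prob (gnp n p) {E. max_degree n E < M}
      = measure_pmf.prob (?Q (all_pairs n)) {b. max_degree n {e \<in> all_pairs n. b e} < M}"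
    by (simp add: gnp_def vimage_def)
  also have "\<dots> \<le> measure_pmf.prob (?Q (all_pairs n)) {b. \<forall>v\<in>{..<h}. card {x \<in> C v. b x} < M}"
  proof (intro measure_pmf.finite_measure_mono subsetI CollectI ballI)
    fix b v assume b: "b \<in> {b. max_degree n {e \<in> all_pairs n. b e} < M}" and v: "v \<in> {..<h}"
    let ?E = "{e \<in> all_pairs n. b e}"
    have "{x \<in> C v. b x} \<subseteq> (\<lambda>w. {w, v}) ` nbrs ?E v"
      using sub v by (auto simp: C_def nbrs_def)
    moreover have "finite (nbrs ?E v)" by (rule finite_nbrs) auto
    ultimately have "card {x \<in> C v. b x} \<le> deg ?E v"
      unfolding deg_def by (rule surj_card_le[rotated])
    also have "\<dots> \<le> max_degree n ?E" using v h by (intro deg_le_max_degree) auto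
    finally show "card {x \<in> C v. b x} < M" using b by simp
  qed auto
  \<comment> \<open>The event depends only on the coordinates in \<open>?U\<close>, so the product
    may be restricted to them.\<close>
  also have "\<dots> = measure_pmf.prob (?Q ?U) {b. \<forall>v\<in>{..<h}. card {x \<in> C v. b x} < M}"
  proof -
    have *: "{x \<in> C v. if x \<in> ?U then b x else False} = {x \<in> C v. b x}" if "v \<in> {..<h}" for v b
      using that by auto
    have "?Q ?U = map_pmf (\<lambda>f x. if x \<in> ?U then f x else False) (?Q (all_pairs n))"
      using sub by (intro Pi_pmf_subset) auto
    hence "measure_pmf.prob (?Q ?U) {b. \<forall>v\<in>{..<h}. card {x \<in> C v. b x} < M} =
      measure_pmf.prob (?Q (all_pairs n)) {b. \<forall>v\<in>{..<h}. card {x \<in> C v. if x \<in> ?U then b x else False} < M}"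
      by (simp only: measure_map_pmf vimage_def mem_Collect_eq)
    also have "{b. \<forall>v\<in>{..<h}. card {x \<in> C v. if x \<in> ?U then b x else False} < M} =
       {b. \<forall>v\<in>{..<h}. card {x \<in> C v. b x} < M}"
      by (intro Collect_cong ball_cong refl) (simp only: *)
    finally show ?thesis by simp
  qed
  also have "\<dots> = measure_pmf.prob (binomial_pmf (n - h) p) {..<M} ^ card {..<h}"
    using cardC disj p finC by (intro prob_all_blocks_less) auto
  finally show ?thesis by simp
qed

text \<open>Let \<open>q\<close> be the probability of exactly \<open>M\<close> successes at one
  vertex. All \<open>h\<close> vertices stay below \<open>M\<close> with probability at most
  \<open>(1 - q) ^ h \<le> exp (- q * h)\<close>. Up to a constant factor, \<open>q * h\<close> is
  at least \<open>n * (c / (2 * M)) ^ M\<close>, and \<open>n \<ge> M ^ (2 * M)\<close> turns this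
  into \<open>(c * M / 2) ^ M\<close>.\<close>

lemma prob_max_degree_less_le:
  fixes c :: real
  assumes c: "c > 0" "2 * c \<le> n" and M: "M \<ge> 2" "2 \<le> c * M" "M ^ (2 * M) \<le> n"
  shows "measure_pmf.prob (gnp n (c / n)) {E. max_degree n E < M} \<le> exp (- (exp (- 2 * c) * c / 6) * M)"
proof -
  define h where "h = n div 2"
  define N where "N = n - h"
  define p where "p = c / n"
  define q where "q = (N choose M) * p ^ M * (1 - p) ^ (N - M)"
  have "2 * M \<le> M * M" using M by simp
  also have "\<dots> = M ^ 2" by (simp add: power2_eq_square)
  also have "\<dots> \<le> M ^ (2 * M)" using M by (intro power_increasing) auto
  finally have nM: "2 * M \<le> n" using M by linarith
  have n4: "n \<ge> 4" using nM M by linarith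
  have NM: "M \<le> N" "n \<le> 2 * N" "N \<le> n" "h \<le> n" using nM by (auto simp: N_def h_def)
  \<comment> \<open>\<open>h\<close> is \<open>n / 2\<close> rounded down; the 3 absorbs the
    rounding.\<close>
  have h3: "real n / 3 \<le> real h" using n4 unfolding h_def by linarith
  have p: "p > 0" "p \<le> 1 / 2" using c n4 by (auto simp: p_def field_simps)
  have q0: "exp (- 2 * c) * (c / (2 * M)) ^ M \<le> q"
  proof -
    have "exp (- 2 * c) \<le> (1 - p) ^ n"
    proof -
      have "- p - 2 * p\<^sup>2 \<le> ln (1 - p)" using p by (intro ln_one_minus_pos_lower_bound) auto
      moreover have "p\<^sup>2 \<le> p * (1 / 2)" unfolding power2_eq_square using p by (intro mult_left_mono) auto
      ultimately have "- 2 * p \<le> ln (1 - p)" by linarith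
      hence "exp (- 2 * p) \<le> exp (ln (1 - p))" by (simp only: exp_le_cancel_iff)
      also have "\<dots> = 1 - p" using p by simp
      finally have "exp (- 2 * p) ^ n \<le> (1 - p) ^ n" by (intro power_mono) auto
      also have "exp (- 2 * p) ^ n = exp (- 2 * c)"
        using n4 by (simp flip: exp_of_nat_mult add: p_def)
      finally show ?thesis .
    qed
    also have "\<dots> \<le> (1 - p) ^ (N - M)" using p NM by (intro power_decreasing) auto
    finally have 1: "exp (- 2 * c) \<le> (1 - p) ^ (N - M)" .
    have "c / (2 * M) \<le> N / M * p"
    proof -
      have "c * real n \<le> c * (2 * real N)" using NM c by (intro mult_left_mono) auto
      thus ?thesis using M n4 by (simp add: p_def field_simps)
    qed
    hence "(c / (2 * M)) ^ M \<le> (N / M * p) ^ M" using c by (intro power_mono) auto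
    also have "\<dots> = (N / M) ^ M * p ^ M" by (rule power_mult_distrib)
    also have "\<dots> \<le> (N choose M) * p ^ M"
      using p NM by (intro mult_right_mono binomial_ge_n_over_k_pow_k) auto
    finally have 2: "(c / (2 * M)) ^ M \<le> (N choose M) * p ^ M" .
    have "exp (- 2 * c) * (c / (2 * M)) ^ M \<le> (1 - p) ^ (N - M) * ((N choose M) * p ^ M)"
      using 1 2 c p by (intro mult_mono) auto
    thus ?thesis by (simp add: q_def mult_ac)
  qed
  have qpmf: "q = pmf (binomial_pmf N p) M" using p NM by (simp add: q_def)
  have "measure_pmf.prob (binomial_pmf N p) {..<M} = 1 - measure_pmf.prob (binomial_pmf N p) {M..}"
    using measure_pmf.prob_compl[of "{M..}" "binomial_pmf N p"] by (simp add: Compl_eq_Diff_UNIV[symmetric] not_le)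
  also have "measure_pmf.prob (binomial_pmf N p) {M..} \<ge> measure_pmf.prob (binomial_pmf N p) {M}"
    by (intro measure_pmf.finite_measure_mono) auto
  hence "1 - measure_pmf.prob (binomial_pmf N p) {M..} \<le> 1 - q"
    by (simp add: qpmf measure_pmf_single)
  also have "\<dots> \<le> exp (- q)" using exp_ge_add_one_self[of "- q"] by simp
  finally have "measure_pmf.prob (binomial_pmf N p) {..<M} ^ h \<le> exp (- q) ^ h"
    by (intro power_mono) auto
  hence "measure_pmf.prob (gnp n p) {E. max_degree n E < M} \<le> exp (- q) ^ h"
    using prob_max_degree_less[of h n p M] NM p unfolding N_def by auto
  also have "\<dots> = exp (- (q * h))" by (simp flip: exp_of_nat_mult add: mult.commute)
  also have "\<dots> \<le> exp (- (exp (- 2 * c) * c / 6) * M)"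
  proof -
    \<comment> \<open>The base is at least 1 by assumption, and its first power suffices for the
      claim.\<close>
    have "c * M / 2 \<le> (c * M / 2) ^ M"
      using power_increasing[of 1 M "c * M / 2"] M by simp
    also have "\<dots> = real M ^ (2 * M) * (c / (2 * M)) ^ M"
      using M by (simp add: power_mult power2_eq_square mult.commute flip: power_mult_distrib)
    also have "\<dots> \<le> n * (c / (2 * M)) ^ M"
    proof (rule mult_right_mono)
      have "real (M ^ (2 * M)) \<le> real n" using M(3) by (rule of_nat_mono)
      thus "real M ^ (2 * M) \<le> real n" by simp
    qed (use c in auto)
    finally have "exp (- 2 * c) / 3 * (c * M / 2) \<le> exp (- 2 * c) / 3 * (n * (c / (2 * M)) ^ M)"
      by (intro mult_left_mono) auto
    also have "\<dots> = (exp (- 2 * c) * (c / (2 * M)) ^ M) * (n / 3)" by simp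
    also have "\<dots> \<le> q * h" using q0 h3 c by (intro mult_mono) (auto intro: order_trans[OF _ q0])
    finally show ?thesis by simp
  qed
  finally show ?thesis by (simp add: p_def)
qed

section \<open>The scale \<open>r\<close> as a function of \<open>n\<close>\<close>

text \<open>With \<open>M = r\<^sup>4\<close>, this is the largest \<open>r\<close> such that \<open>M\<^sup>2\<^sup>M \<le> n\<close>; a vertex has degree
  at least \<open>M\<close> with probability about \<open>M\<^sup>-\<^sup>M\<close>.\<close>

definition scale :: "nat \<Rightarrow> nat" where
  "scale n = (LEAST k. n < Suc k ^ (8 * Suc k ^ 4))"

lemma scale_less: "n < Suc (scale n) ^ (8 * Suc (scale n) ^ 4)"
  unfolding scale_def
proof (rule LeastI)
  \<comment> \<open>The witness for the \<open>LEAST\<close> is \<open>k = Suc n\<close>.\<close>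
  have "n < 2 ^ n" by simp
  also have "\<dots> \<le> (Suc (Suc n)) ^ n" by (intro power_mono) auto
  also have "\<dots> \<le> Suc (Suc n) ^ (8 * Suc (Suc n) ^ 4)"
  proof (rule power_increasing)
    have "Suc (Suc n) ^ 1 \<le> Suc (Suc n) ^ 4" by (intro power_increasing) auto
    thus "n \<le> 8 * Suc (Suc n) ^ 4" by simp
  qed simp
  finally show "n < Suc (Suc n) ^ (8 * Suc (Suc n) ^ 4)" .
qed

lemma scale_power_mono: "j \<le> k \<Longrightarrow> 1 \<le> k \<Longrightarrow> j ^ (8 * j ^ 4) \<le> (k::nat) ^ (8 * k ^ 4)"
  by (rule order_trans[OF power_mono power_increasing]) (auto intro: power_mono)

lemma scale_power_le:
  assumes "scale n \<ge> 1"
  shows "scale n ^ (8 * scale n ^ 4) \<le> n"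
proof -
  obtain k where k: "scale n = Suc k" using assms by (cases "scale n") auto
  hence "\<not> n < Suc k ^ (8 * Suc k ^ 4)"
    using not_less_Least[of k "\<lambda>k. n < Suc k ^ (8 * Suc k ^ 4)"] by (simp add: scale_def)
  thus ?thesis by (simp add: k)
qed

text \<open>Source of the exponent 256: starting from 8, \<open>Suc r \<le> r^2\<close> doubles it
  and \<open>(Suc r) ^ 4 \<le> 16 * r ^ 4\<close> multiplies it by 16.\<close>

lemma le_scale_power:
  assumes "scale n \<ge> 2"
  shows "n \<le> scale n ^ (256 * scale n ^ 4)"
proof -
  define r where "r = scale n"
  have r: "r \<ge> 2" using assms by (simp add: r_def)
  have "Suc r \<le> 2 * r" "2 * r \<le> r\<^sup>2" using r by (auto simp: power2_eq_square)
  have "n \<le> Suc r ^ (8 * Suc r ^ 4)" using scale_less[of n] by (simp add: r_def)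
  also have "\<dots> \<le> (r\<^sup>2) ^ (8 * Suc r ^ 4)" using \<open>Suc r \<le> 2 * r\<close> \<open>2 * r \<le> r\<^sup>2\<close> by (intro power_mono) auto
  also have "\<dots> \<le> (r\<^sup>2) ^ (8 * (2 * r) ^ 4)"
    using r \<open>Suc r \<le> 2 * r\<close> by (intro power_increasing mult_left_mono power_mono) auto
  also have "\<dots> = r ^ (256 * r ^ 4)" by (simp add: power_mult_distrib flip: power_mult)
  finally show ?thesis by (simp add: r_def)
qed

lemma filterlim_scale: "filterlim scale at_top sequentially"
  unfolding filterlim_at_top
proof
  fix R
  have "R \<le> scale n" if "n \<ge> R ^ (8 * R ^ 4)" for n
  proof (rule ccontr)
    assume "\<not> R \<le> scale n"
    hence "Suc (scale n) ^ (8 * Suc (scale n) ^ 4) \<le> R ^ (8 * R ^ 4)"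
      by (intro scale_power_mono) auto
    thus False using that scale_less[of n] by linarith
  qed
  thus "\<forall>\<^sub>F n in sequentially. R \<le> scale n" by (rule eventually_sequentiallyI)
qed

section \<open>Combination of the estimates and passage to the limit\<close>

text \<open>The exceptional events are a maximum degree below \<open>r ^ 4\<close> and the failure
  of sparsity at one of the \<open>t + 1\<close> sizes \<open>m i\<close>. Outside them
  \<open>tau\<close> is at most a constant times \<open>r^2\<close>, and \<open>r^2\<close> is at
  most the root of the maximum degree.\<close>

lemma prob_tau_bounds:
  fixes c :: real
  defines "x \<equiv> max 1 (4 * c) * (exp 1 * c)"
  assumes t: "t \<ge> 3" and c: "c > 0" "2 * c \<le> n"
    and r: "r = scale n" "r \<ge> 9" "x \<le> r" "x ^ 257 \<le> r" "2 \<le> c * r"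
  shows "measure_pmf.prob (gnp n (c / n))
           {E. 1 * sqrt (max_degree n E) \<le> tau t n E \<and>
               tau t n E \<le> real (t * (t * 2 ^ t * (257 * 5 ^ t) + 1)) * sqrt (max_degree n E)}
         \<ge> 1 - (exp (- (exp (- 2 * c) * c / 6) * r) + real (t + 1) * (2 * x ^ 257 / r))"
proof -
  let ?P = "measure_pmf.prob (gnp n (c / n))"
  let ?G = "{E. 1 * sqrt (max_degree n E) \<le> tau t n E \<and>
               tau t n E \<le> real (t * (t * 2 ^ t * (257 * 5 ^ t) + 1)) * sqrt (max_degree n E)}"
  \<comment> \<open>These are the sizes in \<open>sparse_tau_le\<close> with \<open>A = 257\<close>,
    one more than the exponent 256 that bounds \<open>n\<close>.\<close>
  define m where "m i = 257 * r ^ 3 * (5 * r) ^ i" for i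
  let ?B = "{E. max_degree n E < r ^ 4}"
  let ?S = "\<lambda>i. {E. \<not> sparse n E (m i) (4 * r * m i)}"
  have r_n: "r ^ (8 * r ^ 4) \<le> n" "n \<le> r ^ (256 * r ^ 4)"
    using scale_power_le[of n] le_scale_power[of n] r by auto
  have "1 \<le> r ^ (8 * r ^ 4)" using r by simp
  hence n1: "n \<ge> 1" using r_n by linarith
  have good: "E \<in> ?G" if E: "E \<in> set_pmf (gnp n (c / n))" "E \<notin> ?B" "\<And>i. i \<le> t \<Longrightarrow> E \<notin> ?S i" for E
  proof -
    have sub: "E \<subseteq> all_pairs n" by (rule set_pmf_gnp[OF E(1)])
    have "tau t n E \<le> t * ((t * 2 ^ t * (257 * 5 ^ t) + 1) * r\<^sup>2)"
      using t r E(3) by (intro sparse_tau_le[OF sub]) (auto simp: m_def)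
    also have "\<dots> = t * (t * 2 ^ t * (257 * 5 ^ t) + 1) * r\<^sup>2" by (simp only: mult.assoc)
    finally have "real (tau t n E) \<le> real (t * (t * 2 ^ t * (257 * 5 ^ t) + 1) * r\<^sup>2)"
      by (rule of_nat_mono)
    also have "\<dots> = real (t * (t * 2 ^ t * (257 * 5 ^ t) + 1)) * real (r\<^sup>2)"
      by (rule of_nat_mult)
    also have "\<dots> \<le> real (t * (t * 2 ^ t * (257 * 5 ^ t) + 1)) * sqrt (max_degree n E)"
    proof (rule mult_left_mono)
      have "real (r ^ 4) \<le> real (max_degree n E)" using E(2) by (intro of_nat_mono) simp
      hence "(real r ^ 2) ^ 2 \<le> real (max_degree n E)" by (simp flip: power_mult)
      thus "real (r\<^sup>2) \<le> sqrt (max_degree n E)" by (simp add: real_le_rsqrt)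
    qed simp
    finally show ?thesis using sqrt_max_degree_le_tau[OF sub, of t] t by simp
  qed
  have "?P (- ?G) \<le> ?P (?B \<union> (\<Union>i\<in>{..t}. ?S i))"
  proof (rule measure_pmf.finite_measure_mono_AE)
    show "AE E in gnp n (c / n). E \<in> - ?G \<longrightarrow> E \<in> ?B \<union> (\<Union>i\<in>{..t}. ?S i)"
      unfolding AE_measure_pmf_iff using good by blast
  qed auto
  also have "\<dots> \<le> ?P ?B + ?P (\<Union>i\<in>{..t}. ?S i)" by (rule measure_Un_le) auto
  also have "?P (\<Union>i\<in>{..t}. ?S i) \<le> (\<Sum>i\<le>t. ?P (?S i))"
    by (intro measure_pmf.finite_measure_subadditive_finite) auto
  also have "\<dots> \<le> (\<Sum>i\<le>t. 2 * x ^ 257 / r)"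
  proof (rule sum_mono)
    fix i
    have "257 * r ^ 3 * 1 \<le> m i" unfolding m_def using r by (intro mult_left_mono) auto
    thus "?P (?S i) \<le> 2 * x ^ 257 / r"
      unfolding x_def using c n1 r r_n by (intro prob_not_sparse_le) (auto simp: x_def)
  qed
  also have "\<dots> = real (t + 1) * (2 * x ^ 257 / r)" by simp
  also have "?P ?B \<le> exp (- (exp (- 2 * c) * c / 6) * r)"
  proof -
    have rM: "r \<le> r ^ 4" using power_increasing[of 1 4 r] r by simp
    have "?P ?B \<le> exp (- (exp (- 2 * c) * c / 6) * (r ^ 4 :: nat))"
    proof (rule prob_max_degree_less_le[OF c])
      show "2 \<le> r ^ 4" using rM r by linarith
      have "c * r \<le> c * real (r ^ 4)" using c rM by (intro mult_left_mono of_nat_mono) auto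
      thus "2 \<le> c * real (r ^ 4)" using r by linarith
      show "(r ^ 4) ^ (2 * r ^ 4) \<le> n" using r_n(1) by (simp flip: power_mult)
    qed
    also have "\<dots> \<le> exp (- (exp (- 2 * c) * c / 6) * r)"
    proof -
      have "(exp (- 2 * c) * c / 6) * r \<le> (exp (- 2 * c) * c / 6) * real (r ^ 4)"
        using c rM by (intro mult_left_mono of_nat_mono) auto
      thus ?thesis by simp
    qed
    finally show ?thesis .
  qed
  finally have "?P (- ?G) \<le> exp (- (exp (- 2 * c) * c / 6) * r) + real (t + 1) * (2 * x ^ 257 / r)"
    by simp
  moreover have "?P (- ?G) = 1 - ?P ?G"
    using measure_pmf.prob_compl[of ?G "gnp n (c / n)"] unfolding Compl_eq_Diff_UNIV by simp
  ultimately show ?thesis by linarith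
qed

theorem theorem4:
  fixes t :: nat
  assumes "t \<ge> 3"
  shows "\<exists>c1 c2 :: real. c1 > 0 \<and> c2 > 0 \<and>
     (\<forall>c :: real. c > 0 \<longrightarrow>
        (\<lambda>n. measure_pmf.prob (gnp n (c / real n))
           {E. c1 * sqrt (real (max_degree n E)) \<le> real (tau t n E) \<and>
               real (tau t n E) \<le> c2 * sqrt (real (max_degree n E))})
        \<longlonglongrightarrow> 1)"
proof (intro exI conjI allI impI)
  \<comment> \<open>The constants depend on \<open>t\<close> only; \<open>c\<close> merely affects
    how large \<open>n\<close> has to be.\<close>
  let ?c2 = "real (t * (t * 2 ^ t * (257 * 5 ^ t) + 1))"
  show "(1::real) > 0" by simp
  have "t * (t * 2 ^ t * (257 * 5 ^ t) + 1) > 0" using assms by simp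
  thus "?c2 > 0" by (simp only: of_nat_0_less_iff)
  fix c :: real assume c: "c > 0"
  define x where "x = max 1 (4 * c) * (exp 1 * c)"
  define \<kappa> where "\<kappa> = exp (- 2 * c) * c / 6"
  \<comment> \<open>The lower bound of \<open>prob_tau_bounds\<close> depends on \<open>n\<close>
    through \<open>scale n\<close> alone, so its limit is taken in a real variable \<open>y\<close>
    and composed with \<open>scale\<close>.\<close>
  let ?L = "\<lambda>n. 1 - (exp (- \<kappa> * scale n) + real (t + 1) * (2 * x ^ 257 / scale n))"
  have scale: "filterlim (\<lambda>n. real (scale n)) at_top sequentially"
    by (rule filterlim_compose[OF filterlim_real_sequentially filterlim_scale])
  have large: "\<forall>\<^sub>F n in sequentially. b \<le> real (scale n)" for b :: real
    using scale by (simp add: filterlim_at_top)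
  have "\<kappa> > 0" using c by (simp add: \<kappa>_def)
  have "((\<lambda>y. 1 - (exp (- \<kappa> * y) + real (t + 1) * (2 * x ^ 257 / y))) \<longlongrightarrow> 1 - (0 + real (t + 1) * 0)) at_top"
  proof (intro tendsto_intros)
    have "filterlim (\<lambda>y. \<kappa> * y) at_top at_top"
      using \<open>\<kappa> > 0\<close> by (intro filterlim_tendsto_pos_mult_at_top[OF tendsto_const] filterlim_ident)
    thus "((\<lambda>y. exp (- \<kappa> * y)) \<longlongrightarrow> 0) at_top"
      by (intro filterlim_compose[OF exp_at_bot]) (simp add: filterlim_uminus_at_top)
    show "((\<lambda>y. 2 * x ^ 257 / y) \<longlongrightarrow> 0) at_top"
      by (intro tendsto_divide_0[OF tendsto_const] filterlim_at_top_imp_at_infinity filterlim_ident)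
  qed
  hence lim: "?L \<longlonglongrightarrow> 1" using filterlim_compose[OF _ scale] by fastforce
  show "(\<lambda>n. measure_pmf.prob (gnp n (c / real n))
           {E. 1 * sqrt (real (max_degree n E)) \<le> real (tau t n E) \<and>
               real (tau t n E) \<le> ?c2 * sqrt (real (max_degree n E))}) \<longlonglongrightarrow> 1"
  proof (rule tendsto_sandwich[OF _ _ lim tendsto_const])
    have "\<forall>\<^sub>F n in sequentially. 2 * c \<le> real n"
      using filterlim_real_sequentially by (simp add: filterlim_at_top)
    thus "\<forall>\<^sub>F n in sequentially. ?L n \<le> measure_pmf.prob (gnp n (c / real n))
           {E. 1 * sqrt (real (max_degree n E)) \<le> real (tau t n E) \<and>
               real (tau t n E) \<le> ?c2 * sqrt (real (max_degree n E))}"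
      using large[of 9] large[of x] large[of "x ^ 257"] large[of "2 / c"]
    proof eventually_elim
      case (elim n)
      have "2 \<le> c * scale n" using elim(5) c by (simp add: field_simps)
      thus ?case unfolding x_def \<kappa>_def
        using elim c by (intro prob_tau_bounds assms) (auto simp: x_def)
    qed
  qed auto
qed

end
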